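(* Let $\alpha,\beta$ be positive constants, $J\subset\mathbb{R}$ an open interval, and $f,g:J\to\mathbb{R}$ smooth functions. (i) Suppose $\alpha^2 f^2(u)-\beta^2 g^2(u)>0$ and $f'^2(u)+g'^2(u)>0$ for all $u\in J$, and let $\mathcal{M}_1$ be the general rotational surface of first type determined by $f,g,\alpha,\beta$ in the Minkowski space $\mathbb{R}^4_1$. Assume that $\mathcal{M}_1$ is free of flat points. Then $\mathcal{M}_1$ has flat normal connection if and only if on $J$ $$\frac{g' f'' - f' g''}{ f'^2 + g'^2} = - \frac{\alpha^2 f g' + \beta^2 g f'}{\alpha^2 f^2 - \beta^2 g^2}.$$ (ii) Suppose $f'^2(u)-g'^2(u)>0$ and $\alpha^2 f^2(u)+\beta^2 g^2(u)>0$ for all $u\in J$, and let $\mathcal{M}_2$ be the general rotational surface of second type determined by $f,g,\alpha,\beta$ in $\mathbb{R}^4_1$. Assume that $\mathcal{M}_2$ is free of flat points. Then $\mathcal{M}_2$ has flat normal connection if and only if on $J$ $$\frac{g' f'' - f' g''}{ f'^2 - g'^2} = - \frac{\alpha^2 f g' + \beta^2 g f'}{\alpha^2 f^2 + \beta^2 g^2}.$$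
   Context: $\mathbb{R}^4_1$ is $\mathbb{R}^4$ with the metric $\langle x,y\rangle=x_1y_1+x_2y_2+x_3y_3-x_4y_4$. A surface in $\mathbb{R}^4_1$ is spacelike if the induced metric is Riemannian. The general rotational surface of first type is the spacelike surface $$\mathcal{M}_1:\ z(u,v)=\left(f(u)\cos\alpha v,\ f(u)\sin\alpha v,\ g(u)\cosh\beta v,\ g(u)\sinh\beta v\right),\quad u\in J,\ v\in[0,2\pi),$$ where $\alpha^2 f^2-\beta^2 g^2>0$ and $f'^2+g'^2>0$. The general rotational surface of second type is the spacelike surface $$\mathcal{M}_2:\ z(u,v)=\left(f(u)\cos\alpha v,\ f(u)\sin\alpha v,\ g(u)\sinh\beta v,\ g(u)\cosh\beta v\right),\quad u\in J,\ v\in[0,2\pi),$$ where $f'^2-g'^2>0$ and $\alpha^2 f^2+\beta^2 g^2>0$. A spacelike surface has flat normal connection if the curvature of its normal connection $D$ vanishes identically, where $D_x\xi$ is the normal component of the ambient derivative $\nabla'_x\xi$ of a normal vector field $\xi$ along a tangent vector field $x$. Flat points: for a spacelike surface $z=z(u,v)$ with $E=\langle z_u,z_u\rangle$, $F=\langle z_u,z_v\rangle$, $G=\langle z_v,z_v\rangle$, $W=\sqrt{EG-F^2}$, choose a normal frame $\{n_1,n_2\}$ with $\langle n_1,n_1\rangle=1$, $\langle n_2,n_2\rangle=-1$, $\langle n_1,n_2\rangle=0$ and $\{z_u,z_v,n_1,n_2\}$ positively oriented, and put $c_{11}^k=\langle z_{uu},n_k\rangle$, $c_{12}^k=\langle z_{uv},n_k\rangle$,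 $c_{22}^k=\langle z_{vv},n_k\rangle$ ($k=1,2$) and $$L=\tfrac{2}{W}(c_{11}^1c_{12}^2-c_{12}^1c_{11}^2),\quad M=\tfrac{1}{W}(c_{11}^1c_{22}^2-c_{22}^1c_{11}^2),\quad N=\tfrac{2}{W}(c_{12}^1c_{22}^2-c_{22}^1c_{12}^2).$$ A point is a flat point of the surface if $L=M=N=0$ there. The surface is free of flat points if $(L,M,N)\neq(0,0,0)$ at every point. *)

theory Defs
  imports "HOL-Analysis.Analysis"
begin

(* Infinite differentiability on an open set S: every iterated directional derivative is
   differentiable on S.  For real functions of a real variable this says that all iterated
   derivatives are differentiable. *)
definition smooth_on :: "('a::euclidean_space \<Rightarrow> 'b::euclidean_space) \<Rightarrow> 'a set \<Rightarrow> bool" where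
  "smooth_on h S \<longleftrightarrow>
     (\<forall>es. (foldr (\<lambda>e k x. frechet_derivative k (at x) e) es h) differentiable_on S)"

definition mink :: "real^4 \<Rightarrow> real^4 \<Rightarrow> real" where
  "mink x y = x$1 * y$1 + x$2 * y$2 + x$3 * y$3 - x$4 * y$4"

(* A parametrized surface is a map z of (u, v), together with a set D of parameter points. *)

definition du :: "(real \<times> real \<Rightarrow> 'b::real_normed_vector) \<Rightarrow> real \<times> real \<Rightarrow> 'b" where
  "du h p = frechet_derivative h (at p) (1, 0)"

definition dv :: "(real \<times> real \<Rightarrow> 'b::real_normed_vector) \<Rightarrow> real \<times> real \<Rightarrow> 'b" where
  "dv h p = frechet_derivative h (at p) (0, 1)"

definition tangent_plane :: "(real \<times> real \<Rightarrow> real^4) \<Rightarrow> real \<times> real \<Rightarrow> (real^4) set" where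
  "tangent_plane z p = span {du z p, dv z p}"

definition normal_plane :: "(real \<times> real \<Rightarrow> real^4) \<Rightarrow> real \<times> real \<Rightarrow> (real^4) set" where
  "normal_plane z p = {n. \<forall>t \<in> tangent_plane z p. mink n t = 0}"

(* Well defined where the surface is spacelike: there the ambient space is the direct sum of
   the tangent and the normal plane. *)
definition normal_component ::
    "(real \<times> real \<Rightarrow> real^4) \<Rightarrow> real \<times> real \<Rightarrow> real^4 \<Rightarrow> real^4" where
  "normal_component z p w = (THE n. n \<in> normal_plane z p \<and> w - n \<in> tangent_plane z p)"

(* A tangent vector field a z_u + b z_v is represented by its coefficient field X = (a, b) on
   the parameter domain; fields along the surface are functions of the parameters, so the
   ambient derivative along the tangent field is the directional derivative along X, and the
   bracket of tangent fields is represented by the bracket of the coefficient fields. *)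

definition normal_connection ::
    "(real \<times> real \<Rightarrow> real^4) \<Rightarrow> (real \<times> real \<Rightarrow> real \<times> real) \<Rightarrow> (real \<times> real \<Rightarrow> real^4)
      \<Rightarrow> real \<times> real \<Rightarrow> real^4" where
  "normal_connection z X \<xi> p = normal_component z p (frechet_derivative \<xi> (at p) (X p))"

definition lie_bracket ::
    "(real \<times> real \<Rightarrow> real \<times> real) \<Rightarrow> (real \<times> real \<Rightarrow> real \<times> real) \<Rightarrow> real \<times> real \<Rightarrow> real \<times> real"
  where
  "lie_bracket X Y p = frechet_derivative Y (at p) (X p) - frechet_derivative X (at p) (Y p)"

definition normal_curvature ::
    "(real \<times> real \<Rightarrow> real^4) \<Rightarrow> (real \<times> real \<Rightarrow> real \<times> real) \<Rightarrow> (real \<times> real \<Rightarrow> real \<times> real)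
      \<Rightarrow> (real \<times> real \<Rightarrow> real^4) \<Rightarrow> real \<times> real \<Rightarrow> real^4" where
  "normal_curvature z X Y \<xi> p =
     normal_connection z X (normal_connection z Y \<xi>) p
     - normal_connection z Y (normal_connection z X \<xi>) p
     - normal_connection z (lie_bracket X Y) \<xi> p"

(* Fields are taken on an arbitrary open neighbourhood of the point, so that D need not be
   open (z has to be defined around D). *)
definition flat_normal_connection ::
    "(real \<times> real \<Rightarrow> real^4) \<Rightarrow> (real \<times> real) set \<Rightarrow> bool" where
  "flat_normal_connection z D \<longleftrightarrow>
     (\<forall>p \<in> D. \<forall>U X Y \<xi>. open U \<longrightarrow> p \<in> U \<longrightarrow> smooth_on X U \<longrightarrow> smooth_on Y U \<longrightarrow>
        smooth_on \<xi> U \<longrightarrow> (\<forall>q \<in> U. \<xi> q \<in> normal_plane z q) \<longrightarrow>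
        normal_curvature z X Y \<xi> p = 0)"

definition fund_E :: "(real \<times> real \<Rightarrow> real^4) \<Rightarrow> real \<times> real \<Rightarrow> real" where
  "fund_E z p = mink (du z p) (du z p)"

definition fund_F :: "(real \<times> real \<Rightarrow> real^4) \<Rightarrow> real \<times> real \<Rightarrow> real" where
  "fund_F z p = mink (du z p) (dv z p)"

definition fund_G :: "(real \<times> real \<Rightarrow> real^4) \<Rightarrow> real \<times> real \<Rightarrow> real" where
  "fund_G z p = mink (dv z p) (dv z p)"

definition fund_W :: "(real \<times> real \<Rightarrow> real^4) \<Rightarrow> real \<times> real \<Rightarrow> real" where
  "fund_W z p = sqrt (fund_E z p * fund_G z p - (fund_F z p)\<^sup>2)"

definition normal_frame ::
    "(real \<times> real \<Rightarrow> real^4) \<Rightarrow> real \<times> real \<Rightarrow> real^4 \<Rightarrow> real^4 \<Rightarrow> bool" where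
  "normal_frame z p n1 n2 \<longleftrightarrow>
     n1 \<in> normal_plane z p \<and> n2 \<in> normal_plane z p \<and>
     mink n1 n1 = 1 \<and> mink n2 n2 = -1 \<and> mink n1 n2 = 0 \<and>
     det (vector [du z p, dv z p, n1, n2] :: real^4^4) > 0"

definition c11 :: "(real \<times> real \<Rightarrow> real^4) \<Rightarrow> real \<times> real \<Rightarrow> real^4 \<Rightarrow> real" where
  "c11 z p n = mink (du (du z) p) n"

definition c12 :: "(real \<times> real \<Rightarrow> real^4) \<Rightarrow> real \<times> real \<Rightarrow> real^4 \<Rightarrow> real" where
  "c12 z p n = mink (dv (du z) p) n"

definition c22 :: "(real \<times> real \<Rightarrow> real^4) \<Rightarrow> real \<times> real \<Rightarrow> real^4 \<Rightarrow> real" where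
  "c22 z p n = mink (dv (dv z) p) n"

definition coeff_L ::
    "(real \<times> real \<Rightarrow> real^4) \<Rightarrow> real \<times> real \<Rightarrow> real^4 \<Rightarrow> real^4 \<Rightarrow> real" where
  "coeff_L z p n1 n2 = 2 / fund_W z p * (c11 z p n1 * c12 z p n2 - c12 z p n1 * c11 z p n2)"

definition coeff_M ::
    "(real \<times> real \<Rightarrow> real^4) \<Rightarrow> real \<times> real \<Rightarrow> real^4 \<Rightarrow> real^4 \<Rightarrow> real" where
  "coeff_M z p n1 n2 = 1 / fund_W z p * (c11 z p n1 * c22 z p n2 - c22 z p n1 * c11 z p n2)"

definition coeff_N ::
    "(real \<times> real \<Rightarrow> real^4) \<Rightarrow> real \<times> real \<Rightarrow> real^4 \<Rightarrow> real^4 \<Rightarrow> real" where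
  "coeff_N z p n1 n2 = 2 / fund_W z p * (c12 z p n1 * c22 z p n2 - c22 z p n1 * c12 z p n2)"

(* L, M, N do not depend on the choice of the frame: passing to another oriented
   pseudo-orthonormal frame multiplies the 2x2 minors by a determinant equal to 1. *)
definition flat_point :: "(real \<times> real \<Rightarrow> real^4) \<Rightarrow> real \<times> real \<Rightarrow> bool" where
  "flat_point z p \<longleftrightarrow>
     (\<exists>n1 n2. normal_frame z p n1 n2 \<and>
        coeff_L z p n1 n2 = 0 \<and> coeff_M z p n1 n2 = 0 \<and> coeff_N z p n1 n2 = 0)"

definition free_of_flat_points ::
    "(real \<times> real \<Rightarrow> real^4) \<Rightarrow> (real \<times> real) set \<Rightarrow> bool" where
  "free_of_flat_points z D \<longleftrightarrow> (\<forall>p \<in> D. \<not> flat_point z p)"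

definition rot_surface1 ::
    "real \<Rightarrow> real \<Rightarrow> (real \<Rightarrow> real) \<Rightarrow> (real \<Rightarrow> real) \<Rightarrow> real \<times> real \<Rightarrow> real^4" where
  "rot_surface1 \<alpha> \<beta> f g = (\<lambda>(u, v). vector
     [f u * cos (\<alpha> * v), f u * sin (\<alpha> * v), g u * cosh (\<beta> * v), g u * sinh (\<beta> * v)])"

definition rot_surface2 ::
    "real \<Rightarrow> real \<Rightarrow> (real \<Rightarrow> real) \<Rightarrow> (real \<Rightarrow> real) \<Rightarrow> real \<times> real \<Rightarrow> real^4" where
  "rot_surface2 \<alpha> \<beta> f g = (\<lambda>(u, v). vector
     [f u * cos (\<alpha> * v), f u * sin (\<alpha> * v), g u * sinh (\<beta> * v), g u * cosh (\<beta> * v)])"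

end

theory Submission
  imports Defs
begin

text \<open>
  Since the parameter curves are orthogonal, the Ricci equation expresses the curvature of the normal
  connection through the normal parts of \<open>z_uu\<close>, \<open>z_uv\<close>, \<open>z_vv\<close>.  On a rotational surface
  \<open>z_uu\<close> and \<open>z_vv\<close> have normal parts along one normal direction \<open>m1\<close>, and \<open>z_uv\<close> along the
  orthogonal direction \<open>m2\<close>.  The curvature is therefore a rotation of the normal plane multiplied by
  \<open>(f g' - g f')\<close> times the difference of the two sides of the asserted equation, and
  the points with \<open>f g' - g f' = 0\<close> are flat.
\<close>

section \<open>Smooth maps\<close>

text \<open>Flatness is tested on arbitrary smooth fields near a point, whereas
  \<open>smooth_on\<close> speaks only of iterated Frechet derivatives. Closure of smoothness under
  linear maps, sums and bilinear products therefore comes before any geometry, and so does the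
  symmetry of second derivatives, which is the form in which the flatness of the ambient space
  enters the Ricci equation. The normal vectors \<open>m1\<close> and \<open>m2\<close> keep their
  natural lengths, with squares \<open>\<epsilon> E\<close> and \<open>- \<epsilon> G\<close>. Thus
  no square root is ever differentiated, and normalisation happens only pointwise, where a flat
  point has to be exhibited. The exclusion of flat points is what allows the factor
  \<open>f g' - g f'\<close> to be cancelled when the equation is deduced from vanishing
  curvature.\<close>

lemma differentiable_on_open_at:
  assumes "open S" "h differentiable_on S" "x \<in> S"
  shows "(h has_derivative frechet_derivative h (at x)) (at x)"
  using assms differentiable_on_eq_differentiable_at frechet_derivative_works by blast

lemma frechet_derivative_cong_open:
  assumes "open S" "x \<in> S" "\<And>y. y \<in> S \<Longrightarrow> h y = k y" "k differentiable_on S"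
  shows "(h has_derivative frechet_derivative k (at x)) (at x)"
    and "frechet_derivative h (at x) = frechet_derivative k (at x)"
proof -
  show "(h has_derivative frechet_derivative k (at x)) (at x)"
    by (rule has_derivative_transform_within_open[OF differentiable_on_open_at[OF assms(1,4,2)] assms(1,2)])
      (simp add: assms(3))
  then show "frechet_derivative h (at x) = frechet_derivative k (at x)"
    by (rule frechet_derivative_at[symmetric])
qed

lemma differentiable_on_cong:
  assumes "k differentiable_on S" "\<And>x. x \<in> S \<Longrightarrow> h x = k x"
  shows "h differentiable_on S"
  unfolding differentiable_on_def differentiable_def
proof
  fix x assume x: "x \<in> S"
  then obtain D where "(k has_derivative D) (at x within S)"
    using assms(1) unfolding differentiable_on_def differentiable_def by blast
  then show "\<exists>D. (h has_derivative D) (at x within S)"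
    using has_derivative_transform[of x S h k D] x assms(2) by blast
qed

lemma smooth_on_imp_differentiable_on: "smooth_on h S \<Longrightarrow> h differentiable_on S"
  unfolding smooth_on_def by (drule spec[of _ "[]"]) simp

lemma smooth_on_has_derivative:
  assumes "smooth_on h S" "open S" "x \<in> S"
  shows "(h has_derivative frechet_derivative h (at x)) (at x)"
  by (rule differentiable_on_open_at[OF assms(2) smooth_on_imp_differentiable_on[OF assms(1)] assms(3)])

lemma smooth_on_frechet_derivative:
  assumes "smooth_on h S"
  shows "smooth_on (\<lambda>x. frechet_derivative h (at x) e) S"
  unfolding smooth_on_def
proof
  fix es
  show "foldr (\<lambda>e k x. frechet_derivative k (at x) e) es
      (\<lambda>x. frechet_derivative h (at x) e) differentiable_on S"
    \<comment> \<open>\<open>foldr\<close> applies the last entry of the list innermost, so the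
      appended direction is the one differentiated first.\<close>
    using assms[unfolded smooth_on_def, rule_format, of "es @ [e]"] by simp
qed

text \<open>A class of differentiable maps that contains, up to equality on \<open>S\<close>, all
  directional derivatives of its members consists of smooth maps: by induction on the list of
  directions, every iterated derivative agrees on \<open>S\<close> with a member. Agreement on
  \<open>S\<close> suffices because \<open>S\<close> is open, so that derivatives at its points see
  only values on \<open>S\<close>.\<close>

lemma smooth_on_coinduct:
  assumes "open S" "h \<in> K"
    and diff: "\<And>k. k \<in> K \<Longrightarrow> k differentiable_on S"
    and step: "\<And>k e. k \<in> K \<Longrightarrow> \<exists>k'\<in>K. \<forall>x\<in>S. frechet_derivative k (at x) e = k' x"
  shows "smooth_on h S"
  unfolding smooth_on_def
proof
  fix es
  have "\<exists>k\<in>K. \<forall>x\<in>S. foldr (\<lambda>e k x. frechet_derivative k (at x) e) es h x = k x"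
  proof (induction es)
    case Nil
    then show ?case using assms(2) by auto
  next
    case (Cons e es)
    then obtain k where k: "k \<in> K"
      "\<And>x. x \<in> S \<Longrightarrow> foldr (\<lambda>e k x. frechet_derivative k (at x) e) es h x = k x"
      by blast
    obtain k' where "k' \<in> K" "\<forall>x\<in>S. frechet_derivative k (at x) e = k' x"
      using step[OF k(1)] by blast
    then show ?case
      using frechet_derivative_cong_open(2)[OF assms(1) _ k(2) diff[OF k(1)]]
      by (intro bexI[of _ k']) simp_all
  qed
  then obtain k where "k \<in> K"
    "\<And>x. x \<in> S \<Longrightarrow> foldr (\<lambda>e k x. frechet_derivative k (at x) e) es h x = k x"
    by blast
  then show "foldr (\<lambda>e k x. frechet_derivative k (at x) e) es h differentiable_on S"
    by (intro differentiable_on_cong[OF diff])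
qed

lemma smooth_on_cong:
  assumes "smooth_on k S" "open S" "\<And>x. x \<in> S \<Longrightarrow> h x = k x"
  shows "smooth_on h S"
proof (rule smooth_on_coinduct[OF assms(2), where K = "{h. \<exists>k. smooth_on k S \<and> (\<forall>x\<in>S. h x = k x)}"])
  fix h' e assume "h' \<in> {h. \<exists>k. smooth_on k S \<and> (\<forall>x\<in>S. h x = k x)}"
  then obtain k' where k': "smooth_on k' S" "\<And>x. x \<in> S \<Longrightarrow> h' x = k' x" by blast
  note d = smooth_on_imp_differentiable_on[OF k'(1)]
  show "h' differentiable_on S" by (rule differentiable_on_cong[OF d k'(2)])
  show "\<exists>k\<in>{h. \<exists>k. smooth_on k S \<and> (\<forall>x\<in>S. h x = k x)}. 
      \<forall>x\<in>S. frechet_derivative h' (at x) e = k x"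
    using smooth_on_frechet_derivative[OF k'(1), of e]
      frechet_derivative_cong_open(2)[OF assms(2) _ k'(2) d]
    by (intro bexI[of _ "\<lambda>x. frechet_derivative k' (at x) e"]) auto
qed (use assms in auto)

lemma smooth_on_subset:
  assumes "smooth_on h S" "T \<subseteq> S"
  shows "smooth_on h T"
  using assms differentiable_on_subset unfolding smooth_on_def by blast

text \<open>For a linear inner map the chain rule produces no new factors: the derivative of
  \<open>k o l\<close> along \<open>e\<close> is the derivative of \<open>k\<close> along
  \<open>l e\<close>, composed with \<open>l\<close>. The case needed later is that of the two
  coordinate projections.\<close>

lemma smooth_on_compose_linear:
  assumes "smooth_on h S" "open S" "open T" "bounded_linear l" "\<And>x. x \<in> T \<Longrightarrow> l x \<in> S"
  shows "smooth_on (\<lambda>x. h (l x)) T"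
proof (rule smooth_on_coinduct[OF assms(3), where K = "{\<lambda>x. k (l x) |k. smooth_on k S}"])
  fix h' e assume "h' \<in> {\<lambda>x. k (l x) |k. smooth_on k S}"
  then obtain k where k: "smooth_on k S" "h' = (\<lambda>x. k (l x))" by blast
  have D: "(h' has_derivative (\<lambda>e. frechet_derivative k (at (l x)) (l e))) (at x)"
    if "x \<in> T" for x
    unfolding k(2)
    by (rule has_derivative_compose[OF bounded_linear_imp_has_derivative[OF assms(4)]
        smooth_on_has_derivative[OF k(1) assms(2) assms(5)[OF that]]])
  show "h' differentiable_on T"
    using D by (meson differentiableI differentiable_at_imp_differentiable_on)
  show "\<exists>k\<in>{\<lambda>x. k (l x) |k. smooth_on k S}. \<forall>x\<in>T. frechet_derivative h' (at x) e = k x"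
    using frechet_derivative_at[OF D, symmetric] smooth_on_frechet_derivative[OF k(1), of "l e"]
    by (intro bexI[of _ "\<lambda>x. frechet_derivative k (at (l x)) (l e)"]) auto
qed (use assms in auto)

lemma smooth_on_linear_compose:
  assumes "smooth_on h S" "open S" "bounded_linear l"
  shows "smooth_on (\<lambda>x. l (h x)) S"
proof (rule smooth_on_coinduct[OF assms(2), where K = "{\<lambda>x. l (k x) |k. smooth_on k S}"])
  fix h' e assume "h' \<in> {\<lambda>x. l (k x) |k. smooth_on k S}"
  then obtain k where k: "smooth_on k S" "h' = (\<lambda>x. l (k x))" by blast
  have D: "(h' has_derivative (\<lambda>e. l (frechet_derivative k (at x) e))) (at x)"
    if "x \<in> S" for x
    unfolding k(2)
    by (rule bounded_linear.has_derivative[OF assms(3) smooth_on_has_derivative[OF k(1) assms(2) that]])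
  show "h' differentiable_on S"
    using D by (meson differentiableI differentiable_at_imp_differentiable_on)
  show "\<exists>k\<in>{\<lambda>x. l (k x) |k. smooth_on k S}. \<forall>x\<in>S. frechet_derivative h' (at x) e = k x"
    using frechet_derivative_at[OF D, symmetric] smooth_on_frechet_derivative[OF k(1), of e]
    by (intro bexI[of _ "\<lambda>x. l (frechet_derivative k (at x) e)"]) auto
qed (use assms in auto)

lemma smooth_on_add:
  assumes "smooth_on h S" "smooth_on k S" "open S"
  shows "smooth_on (\<lambda>x. h x + k x) S"
proof (rule smooth_on_coinduct[OF assms(3),
      where K = "{\<lambda>x. a x + b x |a b. smooth_on a S \<and> smooth_on b S}"])
  fix h' e assume "h' \<in> {\<lambda>x. a x + b x |a b. smooth_on a S \<and> smooth_on b S}"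
  then obtain a b where k: "smooth_on a S" "smooth_on b S" "h' = (\<lambda>x. a x + b x)" by blast
  have D: "(h' has_derivative (\<lambda>e. frechet_derivative a (at x) e + frechet_derivative b (at x) e)) (at x)"
    if "x \<in> S" for x
    unfolding k(3)
    by (intro has_derivative_add smooth_on_has_derivative[OF k(1) assms(3) that]
        smooth_on_has_derivative[OF k(2) assms(3) that])
  show "h' differentiable_on S"
    using D by (meson differentiableI differentiable_at_imp_differentiable_on)
  show "\<exists>k\<in>{\<lambda>x. a x + b x |a b. smooth_on a S \<and> smooth_on b S}.
      \<forall>x\<in>S. frechet_derivative h' (at x) e = k x"
    using frechet_derivative_at[OF D, symmetric] smooth_on_frechet_derivative[OF k(1), of e]
      smooth_on_frechet_derivative[OF k(2), of e]
    by (intro bexI[of _ "\<lambda>x. frechet_derivative a (at x) e + frechet_derivative b (at x) e"]) auto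
qed (use assms in auto)

text \<open>The Leibniz rule turns one product into a sum of two, so single products are not closed
  under differentiation. Finite sums of products are, and they serve as the class for the
  coinduction.\<close>

inductive_set bilinear_sums ::
    "('b::euclidean_space \<Rightarrow> 'c::euclidean_space \<Rightarrow> 'd::euclidean_space) \<Rightarrow>
      'a::euclidean_space set \<Rightarrow> ('a \<Rightarrow> 'd) set" for b S where
  prod: "smooth_on h S \<Longrightarrow> smooth_on k S \<Longrightarrow> (\<lambda>x. b (h x) (k x)) \<in> bilinear_sums b S"
| add: "h \<in> bilinear_sums b S \<Longrightarrow> k \<in> bilinear_sums b S \<Longrightarrow>
    (\<lambda>x. h x + k x) \<in> bilinear_sums b S"

lemma smooth_on_bilinear:
  assumes "smooth_on h S" "smooth_on k S" "open S" "bounded_bilinear b"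
  shows "smooth_on (\<lambda>x. b (h x) (k x)) S"
proof (rule smooth_on_coinduct[OF assms(3), where K = "bilinear_sums b S"])
  have *: "\<exists>D. (\<forall>x\<in>S. (h has_derivative D x) (at x)) \<and> (\<forall>e. (\<lambda>x. D x e) \<in> bilinear_sums b S)"
    if "h \<in> bilinear_sums b S" for h
    using that
  proof induction
    case (prod h k)
    show ?case
      by (intro exI[of _ "\<lambda>x e. b (h x) (frechet_derivative k (at x) e)
              + b (frechet_derivative h (at x) e) (k x)"] conjI ballI allI
          bounded_bilinear.FDERIV[OF assms(4)] smooth_on_has_derivative[OF _ assms(3)]
          bilinear_sums.intros smooth_on_frechet_derivative prod)
  next
    case (add h k)
    then obtain D1 D2 where
      "\<forall>x\<in>S. (h has_derivative D1 x) (at x)" "\<forall>e. (\<lambda>x. D1 x e) \<in> bilinear_sums b S"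
      "\<forall>x\<in>S. (k has_derivative D2 x) (at x)" "\<forall>e. (\<lambda>x. D2 x e) \<in> bilinear_sums b S"
      by blast
    then show ?case
      by (intro exI[of _ "\<lambda>x e. D1 x e + D2 x e"])
        (auto intro: has_derivative_add bilinear_sums.add)
  qed
  fix h e assume h: "h \<in> bilinear_sums b S"
  obtain D where D: "\<And>x. x \<in> S \<Longrightarrow> (h has_derivative D x) (at x)"
    "\<And>e. (\<lambda>x. D x e) \<in> bilinear_sums b S"
    using *[OF h] by blast
  show "h differentiable_on S"
    using D(1) by (meson differentiableI differentiable_at_imp_differentiable_on)
  show "\<exists>k\<in>bilinear_sums b S. \<forall>x\<in>S. frechet_derivative h (at x) e = k x"
    using frechet_derivative_at[OF D(1), symmetric] D(2)[of e]
    by (intro bexI[of _ "\<lambda>x. D x e"]) auto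
qed (intro bilinear_sums.prod assms)

lemma smooth_on_const: "smooth_on (\<lambda>x. c) S"
proof -
  have "smooth_on (\<lambda>x::'a. c) UNIV"
  proof (rule smooth_on_coinduct[where K = "range (\<lambda>c x. c)"])
    fix k and e :: 'a assume "k \<in> range (\<lambda>(c::'b) (x::'a). c)"
    then obtain c where k: "k = (\<lambda>x. c)" by blast
    show "k differentiable_on UNIV" unfolding k by simp
    show "\<exists>k'\<in>range (\<lambda>c x. c). \<forall>x\<in>UNIV. frechet_derivative k (at x) e = k' x"
      unfolding k by simp
  qed auto
  then show ?thesis using smooth_on_subset by blast
qed

text \<open>On the real line the derivative along \<open>e\<close> is \<open>e\<close> times the
  ordinary derivative, so the family has to absorb scalar factors as well as ordinary
  derivatives.\<close>

lemma smooth_on_real_family: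
  fixes h :: "real \<Rightarrow> 'b::euclidean_space"
  assumes "h \<in> K" and "\<And>k. k \<in> K \<Longrightarrow> \<exists>k'\<in>K. \<forall>x. (k has_vector_derivative k' x) (at x)"
    and scale: "\<And>k c. k \<in> K \<Longrightarrow> (\<lambda>x. c *\<^sub>R k x) \<in> K"
  shows "smooth_on h UNIV"
proof (rule smooth_on_coinduct[OF open_UNIV assms(1)])
  fix k e assume "k \<in> K"
  then obtain k' where k': "k' \<in> K" "\<And>x. (k has_vector_derivative k' x) (at x)"
    using assms(2) by blast
  then have D: "(k has_derivative (\<lambda>e. e *\<^sub>R k' x)) (at x)" for x
    by (simp add: has_vector_derivative_def)
  show "k differentiable_on UNIV"
    using D by (meson differentiableI differentiable_at_imp_differentiable_on)
  show "\<exists>k'\<in>K. \<forall>x\<in>UNIV. frechet_derivative k (at x) e = k' x"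
    using scale[OF k'(1), of e] frechet_derivative_at[OF D, symmetric] by (intro bexI[of _ "\<lambda>x. e *\<^sub>R k' x"]) simp_all
qed

lemma smooth_on_deriv:
  fixes f :: "real \<Rightarrow> real"
  assumes "smooth_on f J" "open J"
  shows "smooth_on (deriv f) J"
    and "x \<in> J \<Longrightarrow> (f has_real_derivative deriv f x) (at x)"
proof -
  show D: "(f has_real_derivative deriv f x) (at x)" if "x \<in> J" for x
    using smooth_on_has_derivative[OF assms that]
    by (metis DERIV_deriv_iff_real_differentiable differentiableI)
  show "smooth_on (deriv f) J"
    by (rule smooth_on_cong[OF smooth_on_frechet_derivative[OF assms(1), of 1] assms(2)])
      (use frechet_derivative_at[OF D[unfolded has_field_derivative_def], symmetric] in simp)
qed

section \<open>Symmetry of second derivatives\<close>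

lemma has_real_derivative_along_line:
  assumes "(h has_derivative h') (at (q + s *\<^sub>R e))"
  shows "((\<lambda>s. h (q + s *\<^sub>R e)) has_real_derivative h' e) (at s)"
proof -
  have "((\<lambda>s. q + s *\<^sub>R e) has_derivative (\<lambda>d. d *\<^sub>R e)) (at s)"
    by (auto intro!: derivative_eq_intros)
  from has_derivative_compose[OF this assms]
  have "((\<lambda>s. h (q + s *\<^sub>R e)) has_derivative (\<lambda>d. h' (d *\<^sub>R e))) (at s)" .
  moreover have "(\<lambda>d. h' (d *\<^sub>R e)) = (*) (h' e)"
    using linear_scale[OF has_derivative_linear[OF assms]] by (simp add: fun_eq_iff)
  ultimately show ?thesis
    by (simp add: has_field_derivative_def)
qed

text \<open>The second difference over a parallelogram is an increment of an increment. One mean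
  value theorem in direction \<open>a\<close> and one in direction \<open>b\<close> turn it into a
  mixed second derivative at an interior point.\<close>

lemma second_difference_mean_value:
  fixes h :: "'a::euclidean_space \<Rightarrow> real"
  assumes "smooth_on h S" "open S" "t > 0"
    and S: "\<And>s r. 0 \<le> s \<Longrightarrow> s \<le> t \<Longrightarrow> 0 \<le> r \<Longrightarrow> r \<le> t \<Longrightarrow> p + s *\<^sub>R a + r *\<^sub>R b \<in> S"
  obtains s r where "0 < s" "s < t" "0 < r" "r < t"
    "h (p + t *\<^sub>R a + t *\<^sub>R b) - h (p + t *\<^sub>R a) - h (p + t *\<^sub>R b) + h p =
      t\<^sup>2 * frechet_derivative (\<lambda>x. frechet_derivative h (at x) a) (at (p + s *\<^sub>R a + r *\<^sub>R b)) b"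
proof -
  let ?ha = "\<lambda>x. frechet_derivative h (at x) a"
  \<comment> \<open>The increment of \<open>h\<close> across the parallelogram in direction
    \<open>b\<close>, as a function of the position along \<open>a\<close>; the second difference is
    \<open>?\<phi> t - ?\<phi> 0\<close>.\<close>
  let ?\<phi> = "\<lambda>s. h ((p + t *\<^sub>R b) + s *\<^sub>R a) - h (p + s *\<^sub>R a)"
  have D\<phi>: "(?\<phi> has_real_derivative ?ha ((p + t *\<^sub>R b) + s *\<^sub>R a) - ?ha (p + s *\<^sub>R a)) (at s)"
    if "0 \<le> s" "s \<le> t" for s
  proof (rule DERIV_diff; rule has_real_derivative_along_line[of h];
      rule smooth_on_has_derivative[OF assms(1,2)])
    show "p + t *\<^sub>R b + s *\<^sub>R a \<in> S" using S[OF that, of t] assms(3) by (simp add: add_ac)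
    show "p + s *\<^sub>R a \<in> S" using S[OF that, of 0] assms(3) by simp
  qed
  obtain s where s: "0 < s" "s < t"
    "?\<phi> t - ?\<phi> 0 = (t - 0) * (?ha ((p + t *\<^sub>R b) + s *\<^sub>R a) - ?ha (p + s *\<^sub>R a))"
    using MVT2[OF assms(3), of ?\<phi> "\<lambda>s. ?ha ((p + t *\<^sub>R b) + s *\<^sub>R a) - ?ha (p + s *\<^sub>R a)"] D\<phi> by blast
  let ?\<psi> = "\<lambda>r. ?ha ((p + s *\<^sub>R a) + r *\<^sub>R b)"
  have D\<psi>: "(?\<psi> has_real_derivative frechet_derivative ?ha (at ((p + s *\<^sub>R a) + r *\<^sub>R b)) b) (at r)"
    if "0 \<le> r" "r \<le> t" for r
    by (rule has_real_derivative_along_line[of ?ha],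
        rule smooth_on_has_derivative[OF smooth_on_frechet_derivative[OF assms(1)] assms(2)],
        rule S[OF _ _ that]) (use s in simp_all)
  obtain r where r: "0 < r" "r < t"
    "?\<psi> t - ?\<psi> 0 = (t - 0) * frechet_derivative ?ha (at ((p + s *\<^sub>R a) + r *\<^sub>R b)) b"
    using MVT2[OF assms(3), of ?\<psi> "\<lambda>r. frechet_derivative ?ha (at ((p + s *\<^sub>R a) + r *\<^sub>R b)) b"] D\<psi> by blast
  show ?thesis
  proof (rule that[OF s(1,2) r(1,2)])
    have "?\<phi> t - ?\<phi> 0 = t * (?\<psi> t - ?\<psi> 0)"
      using s(3) by (simp add: add_ac)
    then show "h (p + t *\<^sub>R a + t *\<^sub>R b) - h (p + t *\<^sub>R a) - h (p + t *\<^sub>R b) + h p =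
      t\<^sup>2 * frechet_derivative ?ha (at (p + s *\<^sub>R a + r *\<^sub>R b)) b"
      unfolding r(3) by (simp add: add_ac power2_eq_square)
  qed
qed

text \<open>The second difference is symmetric in \<open>a\<close> and \<open>b\<close>, so the two
  mixed derivatives take a common value at two possibly different points of a small parallelogram.
  Continuity carries the equality to \<open>p\<close>.\<close>

lemma second_derivative_commute_real:
  fixes h :: "'a::euclidean_space \<Rightarrow> real"
  assumes h: "smooth_on h S" "open S" "p \<in> S"
  shows "frechet_derivative (\<lambda>x. frechet_derivative h (at x) a) (at p) b =
    frechet_derivative (\<lambda>x. frechet_derivative h (at x) b) (at p) a"
    (is "?hab p = ?hba p")
proof (rule ccontr)
  assume ne: "?hab p \<noteq> ?hba p"
  \<comment> \<open>With half the gap as radius, the open balls around the two values are disjoint,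
    and the common value would lie in both.\<close>
  define \<epsilon> where "\<epsilon> = \<bar>?hab p - ?hba p\<bar> / 2"
  have "\<epsilon> > 0" using ne by (simp add: \<epsilon>_def)
  have cont: "isCont ?hab p" "isCont ?hba p"
    by (rule has_derivative_continuous[OF smooth_on_has_derivative[OF smooth_on_frechet_derivative
        [OF smooth_on_frechet_derivative[OF h(1)]] h(2,3)]])+
  then have cont': "(?hab \<longlongrightarrow> ?hab p) (nhds p)" "(?hba \<longlongrightarrow> ?hba p) (nhds p)"
    unfolding isCont_def using tendsto_at_iff_tendsto_nhds[of ?hab p] tendsto_at_iff_tendsto_nhds[of ?hba p]
    by simp_all
  have "\<forall>\<^sub>F x in nhds p. x \<in> S \<and> dist (?hab x) (?hab p) < \<epsilon> \<and> dist (?hba x) (?hba p) < \<epsilon>"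
    by (intro eventually_conj eventually_nhds_in_open tendstoD[OF cont'(1)] tendstoD[OF cont'(2)]
        \<open>\<epsilon> > 0\<close> h(2,3))
  then obtain d where d: "d > 0" "\<And>x. dist x p < d \<Longrightarrow>
      x \<in> S \<and> dist (?hab x) (?hab p) < \<epsilon> \<and> dist (?hba x) (?hba p) < \<epsilon>"
    unfolding eventually_nhds_metric by blast
  \<comment> \<open>Small enough for the whole parallelogram to lie within \<open>d / 2\<close> of
    \<open>p\<close>; the summand 1 keeps the denominator positive when \<open>a\<close> and
    \<open>b\<close> both vanish.\<close>
  define t where "t = d / (2 * (norm a + norm b + 1))"
  have n0: "norm a + norm b + 1 > 0" by (smt (verit) norm_ge_zero)
  have t: "t > 0" using d(1) n0 by (simp add: t_def)
  have near: "dist (p + s *\<^sub>R a + r *\<^sub>R b) p < d"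
    if "0 \<le> s" "s \<le> t" "0 \<le> r" "r \<le> t" for s r
  proof -
    have "dist (p + s *\<^sub>R a + r *\<^sub>R b) p = norm (s *\<^sub>R a + r *\<^sub>R b)"
      by (simp add: dist_norm add.assoc)
    also have "\<dots> \<le> s * norm a + r * norm b"
      using norm_triangle_ineq[of "s *\<^sub>R a" "r *\<^sub>R b"] that by simp
    also have "\<dots> \<le> t * norm a + t * norm b"
      using that by (intro add_mono mult_right_mono) auto
    also have "\<dots> < t * (norm a + norm b + 1)" using t by (simp add: algebra_simps)
    also have "\<dots> = d / 2" 
    proof -
      have "d / (2 * N) * N = d / 2" if "N > 0" for N :: real using that by simp
      from this[OF n0] show ?thesis unfolding t_def .
    qed
    also have "\<dots> < d" using d(1) by simp
    finally show ?thesis .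
  qed
  have near': "dist (p + s *\<^sub>R b + r *\<^sub>R a) p < d"
    if "0 \<le> s" "s \<le> t" "0 \<le> r" "r \<le> t" for s r
    using near[of r s] that by (simp add: add_ac)
  obtain s r where 1: "0 < s" "s < t" "0 < r" "r < t"
    "h (p + t *\<^sub>R a + t *\<^sub>R b) - h (p + t *\<^sub>R a) - h (p + t *\<^sub>R b) + h p =
      t\<^sup>2 * ?hab (p + s *\<^sub>R a + r *\<^sub>R b)"
    by (rule second_difference_mean_value[OF h(1,2) t, of p a b]) (use d(2) near in blast)
  obtain s' r' where 2: "0 < s'" "s' < t" "0 < r'" "r' < t"
    "h (p + t *\<^sub>R b + t *\<^sub>R a) - h (p + t *\<^sub>R b) - h (p + t *\<^sub>R a) + h p =
      t\<^sup>2 * ?hba (p + s' *\<^sub>R b + r' *\<^sub>R a)"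
    by (rule second_difference_mean_value[OF h(1,2) t, of p b a]) (use d(2) near' in blast)
  have "t\<^sup>2 * ?hab (p + s *\<^sub>R a + r *\<^sub>R b) = t\<^sup>2 * ?hba (p + s' *\<^sub>R b + r' *\<^sub>R a)"
    unfolding 1(5)[symmetric] 2(5)[symmetric] by (simp add: algebra_simps)
  then have "?hab (p + s *\<^sub>R a + r *\<^sub>R b) = ?hba (p + s' *\<^sub>R b + r' *\<^sub>R a)"
    using t by simp
  moreover have "dist (?hab (p + s *\<^sub>R a + r *\<^sub>R b)) (?hab p) < \<epsilon>"
    using d(2) near 1 by simp
  moreover have "dist (?hba (p + s' *\<^sub>R b + r' *\<^sub>R a)) (?hba p) < \<epsilon>"
    using d(2) near' 2 by simp
  ultimately show False unfolding dist_real_def \<epsilon>_def by argo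
qed

text \<open>The mean value theorem is a statement about real functions, so the vector-valued case is
  reduced to the coordinates, which commute with directional derivatives.\<close>

lemma second_derivative_commute:
  fixes h :: "'a::euclidean_space \<Rightarrow> 'b::euclidean_space"
  assumes h: "smooth_on h S" "open S" "p \<in> S"
  shows "frechet_derivative (\<lambda>x. frechet_derivative h (at x) a) (at p) b =
    frechet_derivative (\<lambda>x. frechet_derivative h (at x) b) (at p) a"
proof (rule euclidean_eqI)
  fix i :: 'b assume "i \<in> Basis"
  have comp: "frechet_derivative (\<lambda>x. k x \<bullet> i) (at q) c = frechet_derivative k (at q) c \<bullet> i"
    if k: "smooth_on k S" and q: "q \<in> S" for k :: "'a \<Rightarrow> 'b" and q c
  proof -
    have "((\<lambda>x. k x \<bullet> i) has_derivative (\<lambda>c. frechet_derivative k (at q) c \<bullet> i)) (at q)"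
      by (rule has_derivative_inner_left[OF smooth_on_has_derivative[OF k h(2) q]])
    from frechet_derivative_at[OF this] show ?thesis by (simp add: fun_eq_iff)
  qed
  have comp2: "frechet_derivative (\<lambda>x. frechet_derivative (\<lambda>x. h x \<bullet> i) (at x) c) (at p) c' =
      frechet_derivative (\<lambda>x. frechet_derivative h (at x) c) (at p) c' \<bullet> i" for c c'
  proof -
    note hc = smooth_on_frechet_derivative[OF h(1), of c]
    have s: "smooth_on (\<lambda>x. frechet_derivative h (at x) c \<bullet> i) S"
      by (rule smooth_on_linear_compose[OF hc h(2) bounded_linear_inner_left])
    have "frechet_derivative (\<lambda>x. frechet_derivative (\<lambda>x. h x \<bullet> i) (at x) c) (at p) =
        frechet_derivative (\<lambda>x. frechet_derivative h (at x) c \<bullet> i) (at p)"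
      by (rule frechet_derivative_cong_open(2)[OF h(2,3) _ smooth_on_imp_differentiable_on[OF s]])
        (rule comp[OF h(1)])
    then show ?thesis
      using comp[OF hc h(3), of c'] by simp
  qed
  have "smooth_on (\<lambda>x. h x \<bullet> i) S"
    by (rule smooth_on_linear_compose[OF h(1,2) bounded_linear_inner_left])
  from second_derivative_commute_real[OF this h(2,3), of a b]
  show "frechet_derivative (\<lambda>x. frechet_derivative h (at x) a) (at p) b \<bullet> i =
      frechet_derivative (\<lambda>x. frechet_derivative h (at x) b) (at p) a \<bullet> i"
    unfolding comp2 .
qed

section \<open>The Ricci equation in an orthogonal chart\<close>

lemma bounded_bilinear_mink: "bounded_bilinear mink"
  unfolding bilinear_conv_bounded_bilinear[symmetric] bilinear_def
  by (auto intro!: linearI simp: mink_def algebra_simps)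

interpretation mink: bounded_bilinear mink
  by (rule bounded_bilinear_mink)

lemma mink_commute: "mink x y = mink y x"
  by (simp add: mink_def)

lemma tangent_plane_iff: "t \<in> tangent_plane z p \<longleftrightarrow> (\<exists>a b. t = a *\<^sub>R du z p + b *\<^sub>R dv z p)"
  unfolding tangent_plane_def span_breakdown_eq span_empty
  by (auto simp: algebra_simps)

lemma normal_plane_iff:
  "n \<in> normal_plane z p \<longleftrightarrow> mink n (du z p) = 0 \<and> mink n (dv z p) = 0"
proof
  assume n: "n \<in> normal_plane z p"
  have "du z p \<in> tangent_plane z p" "dv z p \<in> tangent_plane z p"
    unfolding tangent_plane_def by (simp_all add: span_base)
  then show "mink n (du z p) = 0 \<and> mink n (dv z p) = 0"
    using n unfolding normal_plane_def by blast
qed (auto simp: normal_plane_def tangent_plane_iff mink.add_right mink.scaleR_right)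

text \<open>A diagonal, positive definite first fundamental form: projecting to the tangent plane
  then requires division by \<open>E\<close> and \<open>G\<close> only, without inverting a Gram
  matrix.\<close>

definition orthogonal_chart :: "(real \<times> real \<Rightarrow> real^4) \<Rightarrow> real \<times> real \<Rightarrow> bool" where
  "orthogonal_chart z p \<longleftrightarrow> fund_E z p > 0 \<and> fund_F z p = 0 \<and> fund_G z p > 0"

text \<open>Uniqueness for the definite description: the difference of two candidates is both
  tangent and normal, and its products with \<open>du z p\<close> and \<open>dv z p\<close> are its
  coefficients times \<open>E\<close> and \<open>G\<close>, so both coefficients vanish.\<close>

lemma normal_component_eqI:
  assumes "orthogonal_chart z p" "n \<in> normal_plane z p"
  shows "normal_component z p (a *\<^sub>R du z p + b *\<^sub>R dv z p + n) = n"
  unfolding normal_component_def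
proof (rule the_equality)
  show "n \<in> normal_plane z p \<and> a *\<^sub>R du z p + b *\<^sub>R dv z p + n - n \<in> tangent_plane z p"
    using assms by (auto simp: tangent_plane_iff)
next
  fix n'
  assume n': "n' \<in> normal_plane z p \<and> a *\<^sub>R du z p + b *\<^sub>R dv z p + n - n' \<in> tangent_plane z p"
  then obtain c d where "a *\<^sub>R du z p + b *\<^sub>R dv z p + n - n' = c *\<^sub>R du z p + d *\<^sub>R dv z p"
    unfolding tangent_plane_iff by blast
  then have eq: "n' - n = (a - c) *\<^sub>R du z p + (b - d) *\<^sub>R dv z p"
    by (simp add: algebra_simps)
  have "mink (n' - n) (du z p) = 0" "mink (n' - n) (dv z p) = 0"
    using n' assms(2) by (simp_all add: normal_plane_iff mink.diff_left)
  then have "a - c = 0 \<and> b - d = 0"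
    unfolding eq using assms(1) mink_commute[of "dv z p" "du z p"]
    by (simp add: orthogonal_chart_def fund_E_def fund_F_def fund_G_def mink.add_left mink.scaleR_left)
  with eq show "n' = n" by simp
qed

lemma normal_component_eq:
  assumes "orthogonal_chart z p"
  shows "normal_component z p w =
    w - (mink w (du z p) / fund_E z p) *\<^sub>R du z p - (mink w (dv z p) / fund_G z p) *\<^sub>R dv z p"
proof -
  let ?n = "w - (mink w (du z p) / fund_E z p) *\<^sub>R du z p - (mink w (dv z p) / fund_G z p) *\<^sub>R dv z p"
  have "?n \<in> normal_plane z p"
    using assms mink_commute[of "dv z p" "du z p"]
    by (simp add: orthogonal_chart_def normal_plane_iff mink.diff_left mink.scaleR_left)
      (simp add: fund_E_def fund_F_def fund_G_def)
  from normal_component_eqI[OF assms this, of "mink w (du z p) / fund_E z p" "mink w (dv z p) / fund_G z p"]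
  show ?thesis by simp
qed

lemma linear_normal_component: "orthogonal_chart z p \<Longrightarrow> linear (normal_component z p)"
  by (intro linearI)
    (simp_all add: normal_component_eq mink.add_left mink.scaleR_left add_divide_distrib algebra_simps)

lemma normal_component_tangent:
  assumes "orthogonal_chart z p"
  shows "normal_component z p (du z p) = 0" "normal_component z p (dv z p) = 0"
  using normal_component_eqI[OF assms, of 0 1 0] normal_component_eqI[OF assms, of 0 0 1]
  by (simp_all add: normal_plane_iff mink.zero_left)

section \<open>Derivatives along tangent fields and the curvature of the normal connection\<close>

lemma derivative_du_dv:
  assumes "smooth_on h V" "open V" "p \<in> V"
  shows "frechet_derivative h (at p) x = fst x *\<^sub>R du h p + snd x *\<^sub>R dv h p"
proof -
  have lin: "linear (frechet_derivative h (at p))"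
    using smooth_on_has_derivative[OF assms] has_derivative_linear by blast
  have "x = fst x *\<^sub>R (1, 0) + snd x *\<^sub>R (0, 1)" by (simp add: prod_eq_iff)
  then have "frechet_derivative h (at p) x =
      frechet_derivative h (at p) (fst x *\<^sub>R (1, 0) + snd x *\<^sub>R (0, 1))" by simp
  then show ?thesis
    by (simp only: linear_add[OF lin] linear_scale[OF lin] du_def dv_def)
qed

lemma smooth_on_du: "smooth_on h V \<Longrightarrow> smooth_on (du h) V"
  and smooth_on_dv: "smooth_on h V \<Longrightarrow> smooth_on (dv h) V"
  unfolding du_def dv_def by (rule smooth_on_frechet_derivative, assumption)+

lemma dv_du_commute:
  assumes "smooth_on h V" "open V" "p \<in> V"
  shows "dv (du h) p = du (dv h) p"
  unfolding du_def dv_def by (rule second_derivative_commute[OF assms])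

lemma derivative_along_field:
  fixes h :: "real \<times> real \<Rightarrow> 'b::euclidean_space"
  assumes "smooth_on h V" "smooth_on Y V" "open V" "p \<in> V"
  shows "((\<lambda>q. frechet_derivative h (at q) (Y q)) has_derivative
      (\<lambda>x. frechet_derivative h (at p) (frechet_derivative Y (at p) x)
        + (fst (Y p) *\<^sub>R frechet_derivative (du h) (at p) x
          + snd (Y p) *\<^sub>R frechet_derivative (dv h) (at p) x))) (at p)"
proof (rule has_derivative_transform_within_open[OF _ assms(3,4)])
  show "((\<lambda>q. fst (Y q) *\<^sub>R du h q + snd (Y q) *\<^sub>R dv h q) has_derivative
      (\<lambda>x. frechet_derivative h (at p) (frechet_derivative Y (at p) x)
        + (fst (Y p) *\<^sub>R frechet_derivative (du h) (at p) x
          + snd (Y p) *\<^sub>R frechet_derivative (dv h) (at p) x))) (at p)"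
    unfolding derivative_du_dv[OF assms(1,3,4)]
    by (rule derivative_eq_intros refl smooth_on_has_derivative[OF assms(2-4)]
        smooth_on_has_derivative[OF smooth_on_du[OF assms(1)] assms(3,4)]
        smooth_on_has_derivative[OF smooth_on_dv[OF assms(1)] assms(3,4)])+
      (simp add: algebra_simps)
qed (simp add: derivative_du_dv[OF assms(1,3)])

text \<open>Flatness of the ambient space: the second-order terms cancel because
  \<open>h_uv = h_vu\<close>, and the terms in which the coefficient fields are differentiated form
  the bracket.\<close>

lemma derivative_commutator:
  fixes h :: "real \<times> real \<Rightarrow> 'b::euclidean_space"
  assumes "smooth_on h V" "smooth_on X V" "smooth_on Y V" "open V" "p \<in> V"
  shows "frechet_derivative (\<lambda>q. frechet_derivative h (at q) (Y q)) (at p) (X p)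
    - frechet_derivative (\<lambda>q. frechet_derivative h (at q) (X q)) (at p) (Y p)
    = frechet_derivative h (at p) (lie_bracket X Y p)"
proof -
  note XY = frechet_derivative_at[OF derivative_along_field[OF assms(1,2,4,5)], symmetric]
    frechet_derivative_at[OF derivative_along_field[OF assms(1,3,4,5)], symmetric]
  have lin: "linear (frechet_derivative h (at p))"
    using smooth_on_has_derivative[OF assms(1,4,5)] has_derivative_linear by blast
  show ?thesis
    unfolding XY lie_bracket_def linear_diff[OF lin]
      derivative_du_dv[OF smooth_on_du[OF assms(1)] assms(4,5)]
      derivative_du_dv[OF smooth_on_dv[OF assms(1)] assms(4,5)]
      dv_du_commute[OF assms(1,4,5)]
    by (simp add: algebra_simps)
qed

text \<open>Differentiating the identity \<open>mink \<xi> t = 0\<close> gives the Weingarten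
  relation. It trades the derivative of a normal field for a second derivative of the surface, so
  that only the value of the normal field at \<open>p\<close> remains.\<close>

lemma mink_derivative_orthogonal:
  assumes "smooth_on \<xi> V" "smooth_on t V" "open V" "p \<in> V"
    and orth: "\<And>q. q \<in> V \<Longrightarrow> mink (\<xi> q) (t q) = 0"
  shows "mink (frechet_derivative \<xi> (at p) x) (t p) = - mink (\<xi> p) (frechet_derivative t (at p) x)"
proof -
  have "((\<lambda>q. mink (\<xi> q) (t q)) has_derivative (\<lambda>x. mink (\<xi> p) (frechet_derivative t (at p) x) +
      mink (frechet_derivative \<xi> (at p) x) (t p))) (at p)"
    by (intro mink.FDERIV smooth_on_has_derivative[OF _ assms(3,4)] assms(1,2))
  moreover have "((\<lambda>q. mink (\<xi> q) (t q)) has_derivative (\<lambda>x. 0)) (at p)"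
    by (rule has_derivative_transform_within_open[OF has_derivative_const assms(3,4)])
      (simp add: orth)
  ultimately have "(\<lambda>x. mink (\<xi> p) (frechet_derivative t (at p) x) +
      mink (frechet_derivative \<xi> (at p) x) (t p)) = (\<lambda>x. 0)"
    by (rule has_derivative_unique)
  then show ?thesis by (metis add_eq_0_iff2 add.commute)
qed

text \<open>The inner derivative is the ambient one minus its tangential part
  \<open>a z_u + b z_v\<close>. Upon differentiating again, the terms with derivatives of
  \<open>a\<close> and \<open>b\<close> are tangent and are projected away, while \<open>a\<close>
  and \<open>b\<close> themselves are rewritten by the Weingarten relation.\<close>

lemma normal_connection_twice:
  assumes "smooth_on z V" "smooth_on \<xi> V" "smooth_on Y V" "open V" "p \<in> V"
    and chart: "\<forall>q\<in>V. orthogonal_chart z q"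
    and normal: "\<forall>q\<in>V. \<xi> q \<in> normal_plane z q"
  shows "normal_connection z X (normal_connection z Y \<xi>) p =
    normal_component z p (frechet_derivative (\<lambda>q. frechet_derivative \<xi> (at q) (Y q)) (at p) (X p))
    + (mink (\<xi> p) (frechet_derivative (du z) (at p) (Y p)) / fund_E z p) *\<^sub>R
        normal_component z p (frechet_derivative (du z) (at p) (X p))
    + (mink (\<xi> p) (frechet_derivative (dv z) (at p) (Y p)) / fund_G z p) *\<^sub>R
        normal_component z p (frechet_derivative (dv z) (at p) (X p))"
proof -
  define A where "A = (\<lambda>q. frechet_derivative \<xi> (at q) (Y q))"
  define a where "a q = mink (A q) (du z q) / fund_E z q" for q
  define b where "b q = mink (A q) (dv z q) / fund_G z q" for q
  note du_smooth = smooth_on_du[OF assms(1)] and dv_smooth = smooth_on_dv[OF assms(1)]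
  note Du = smooth_on_has_derivative[OF du_smooth assms(4,5)]
  note Dv = smooth_on_has_derivative[OF dv_smooth assms(4,5)]
  have DA: "(A has_derivative frechet_derivative A (at p)) (at p)"
    using derivative_along_field[OF assms(2-5)] differentiableI frechet_derivative_works
    unfolding A_def by blast
  have "fund_E z p \<noteq> 0" "fund_G z p \<noteq> 0"
    using bspec[OF chart assms(5)] by (auto simp: orthogonal_chart_def)
  \<comment> \<open>Mere existence of these derivatives is enough, since they multiply the tangent
    vectors \<open>du z p\<close> and \<open>dv z p\<close>.\<close>
  then have "a differentiable at p" "b differentiable at p"
    unfolding a_def b_def fund_E_def fund_G_def differentiable_def
    using has_derivative_divide[OF mink.FDERIV[OF DA Du] mink.FDERIV[OF Du Du]]
      has_derivative_divide[OF mink.FDERIV[OF DA Dv] mink.FDERIV[OF Dv Dv]] by blast+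
  then obtain a' b' where Da: "(a has_derivative a') (at p)" and Db: "(b has_derivative b') (at p)"
    unfolding differentiable_def by blast
  have "(normal_connection z Y \<xi> has_derivative
      (\<lambda>x. frechet_derivative A (at p) x - (a p *\<^sub>R frechet_derivative (du z) (at p) x + a' x *\<^sub>R du z p)
        - (b p *\<^sub>R frechet_derivative (dv z) (at p) x + b' x *\<^sub>R dv z p))) (at p)"
    by (rule has_derivative_transform_within_open[OF has_derivative_diff[OF has_derivative_diff[OF DA
              has_derivative_scaleR[OF Da Du]] has_derivative_scaleR[OF Db Dv]] assms(4,5)])
      (simp add: normal_connection_def normal_component_eq chart A_def a_def b_def)
  note D = frechet_derivative_at[OF this, symmetric]
  have ap: "a p = - (mink (\<xi> p) (frechet_derivative (du z) (at p) (Y p)) / fund_E z p)"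
    unfolding a_def A_def
    using mink_derivative_orthogonal[OF assms(2) du_smooth assms(4,5)] normal
    by (simp add: normal_plane_iff)
  have bp: "b p = - (mink (\<xi> p) (frechet_derivative (dv z) (at p) (Y p)) / fund_G z p)"
    unfolding b_def A_def
    using mink_derivative_orthogonal[OF assms(2) dv_smooth assms(4,5)] normal
    by (simp add: normal_plane_iff)
  note lin = linear_normal_component[OF bspec[OF chart assms(5)]]
  show ?thesis
    unfolding normal_connection_def[of z X] D
    by (simp add: linear_add[OF lin] linear_diff[OF lin] linear_scale[OF lin]
        normal_component_tangent[OF bspec[OF chart assms(5)]] ap bp A_def)
qed

text \<open>The ambient second derivatives of the normal field cancel against the bracket term. What
  remains is bilinear and alternating in the values \<open>X p\<close> and \<open>Y p\<close>, hence
  a multiple of their determinant.\<close>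

lemma normal_curvature_Ricci:
  assumes "smooth_on z V" "smooth_on \<xi> V" "smooth_on X V" "smooth_on Y V" "open V" "p \<in> V"
    and chart: "\<forall>q\<in>V. orthogonal_chart z q"
    and normal: "\<forall>q\<in>V. \<xi> q \<in> normal_plane z q"
  shows "normal_curvature z X Y \<xi> p =
    (fst (X p) * snd (Y p) - snd (X p) * fst (Y p)) *\<^sub>R
     ((c12 z p (\<xi> p) / fund_E z p) *\<^sub>R normal_component z p (du (du z) p)
      - (c11 z p (\<xi> p) / fund_E z p) *\<^sub>R normal_component z p (dv (du z) p)
      + (c22 z p (\<xi> p) / fund_G z p) *\<^sub>R normal_component z p (dv (du z) p)
      - (c12 z p (\<xi> p) / fund_G z p) *\<^sub>R normal_component z p (dv (dv z) p))"
proof -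
  note lin = linear_normal_component[OF bspec[OF chart assms(6)]]
  have E: "fund_E z p \<noteq> 0" "fund_G z p \<noteq> 0"
    using bspec[OF chart assms(6)] by (auto simp: orthogonal_chart_def)
  have 0: "normal_component z p (frechet_derivative (\<lambda>q. frechet_derivative \<xi> (at q) (Y q)) (at p) (X p))
    - normal_component z p (frechet_derivative (\<lambda>q. frechet_derivative \<xi> (at q) (X q)) (at p) (Y p))
    - normal_component z p (frechet_derivative \<xi> (at p) (lie_bracket X Y p)) = 0"
    unfolding linear_diff[OF lin, symmetric] derivative_commutator[OF assms(2-6)]
    by (simp add: linear_0[OF lin])
  have rearrange: "(a1 + b1 + c1) - (a2 + b2 + c2) - d = (b1 + c1) - (b2 + c2)"
    if "a1 - a2 - d = 0" for a1 b1 c1 a2 b2 c2 d :: "real^4"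
    using that by (simp add: algebra_simps)
  note D = derivative_du_dv[OF smooth_on_du[OF assms(1)] assms(5,6)]
    derivative_du_dv[OF smooth_on_dv[OF assms(1)] assms(5,6)]
  show ?thesis
    unfolding normal_curvature_def normal_connection_twice[OF assms(1,2,4-8)]
      normal_connection_twice[OF assms(1,2,3,5-8)]
    unfolding normal_connection_def rearrange[OF 0]
    unfolding D dv_du_commute[OF assms(1,5,6), symmetric] linear_add[OF lin] linear_scale[OF lin]
      c11_def c12_def c22_def mink_commute[of _ "\<xi> p"] mink.add_right mink.scaleR_right
    using E by (simp add: algebra_simps add_divide_distrib)
qed

section \<open>Rotational surfaces\<close>

lemma vector_4 [simp]:
  "(vector [a, b, c, d] :: 'a::zero^4) $ 1 = a"
  "(vector [a, b, c, d] :: 'a::zero^4) $ 2 = b"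
  "(vector [a, b, c, d] :: 'a::zero^4) $ 3 = c"
  "(vector [a, b, c, d] :: 'a::zero^4) $ 4 = d"
  unfolding vector_def by simp_all

lemma vec4_eqI: "x $ 1 = y $ 1 \<Longrightarrow> x $ 2 = y $ 2 \<Longrightarrow> x $ 3 = y $ 3 \<Longrightarrow> x $ 4 = y $ 4 \<Longrightarrow> x = (y :: 'a^4)"
  by (simp add: vec_eq_iff forall_4)

lemma mink_normal_component:
  assumes "orthogonal_chart z p" "n \<in> normal_plane z p"
  shows "mink (normal_component z p w) n = mink w n"
  using assms(2)
  by (simp add: normal_component_eq[OF assms(1)] normal_plane_iff mink.diff_right mink.scaleR_right
      mink_commute[of _ n])

text \<open>The Gram matrix of the rows of \<open>A\<close> for the Minkowski product is \<open>A \<eta> A\<^sup>T\<close>.\<close>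

lemma det_nonzero_of_mink_orthogonal:
  fixes A :: "real^4^4"
  assumes "\<And>i j. i \<noteq> j \<Longrightarrow> mink (A $ i) (A $ j) = 0" "\<And>i. mink (A $ i) (A $ i) \<noteq> 0"
  shows "det A \<noteq> 0"
proof -
  define \<eta> :: "real^4^4" where "\<eta> = (\<chi> i j. if i = j then if i = 4 then -1 else 1 else 0)"
  have gram: "(A ** \<eta> ** transpose A) $ i $ j = mink (A $ i) (A $ j)" for i j
    by (simp add: matrix_matrix_mult_def sum_4 \<eta>_def transpose_def mink_def)
  have "det (A ** \<eta> ** transpose A) = (\<Prod>i\<in>UNIV. mink (A $ i) (A $ i))"
    using det_diagonal[of "A ** \<eta> ** transpose A"] assms(1) by (simp add: gram)
  also have "\<dots> \<noteq> 0" using assms(2) by simp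
  finally show ?thesis by (auto simp: det_mul)
qed

text \<open>A flat point is witnessed by a normalised, positively oriented frame. Scaling achieves
  the lengths, the diagonal Gram matrix makes the determinant nonzero, and replacing
  \<open>s\<close> by \<open>- s\<close> reverses its sign without disturbing the other
  conditions.\<close>

lemma normal_frame_exists:
  assumes "orthogonal_chart z p" "m1 \<in> normal_plane z p" "m2 \<in> normal_plane z p"
    and "mink m1 m1 > 0" "mink m2 m2 < 0" "mink m1 m2 = 0"
  shows "\<exists>r s. normal_frame z p (r *\<^sub>R m1) (s *\<^sub>R m2)"
proof -
  define r where "r = 1 / sqrt (mink m1 m1)"
  define s where "s = 1 / sqrt (- mink m2 m2)"
  have r: "r * (r * mink m1 m1) = 1"
    using assms(4) by (simp add: r_def field_simps)
  have s: "s * (s * mink m2 m2) = -1"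
    using assms(5) by (simp add: s_def field_simps)
  have gram: "mink (r *\<^sub>R m1) (r *\<^sub>R m1) = 1" "mink (s *\<^sub>R m2) (s *\<^sub>R m2) = -1"
    "mink (r *\<^sub>R m1) (s *\<^sub>R m2) = 0"
    using r s assms(6) by (simp_all add: mink.scaleR_left mink.scaleR_right)
  have normal: "r *\<^sub>R m1 \<in> normal_plane z p" "s *\<^sub>R m2 \<in> normal_plane z p"
    using assms(2,3) by (simp_all add: normal_plane_iff mink.scaleR_left)
  let ?A = "\<lambda>n. vector [du z p, dv z p, r *\<^sub>R m1, n] :: real^4^4"
  have "det (?A (s *\<^sub>R m2)) \<noteq> 0"
  proof (rule det_nonzero_of_mink_orthogonal)
    have "\<forall>i j. i \<noteq> j \<longrightarrow> mink (?A (s *\<^sub>R m2) $ i) (?A (s *\<^sub>R m2) $ j) = 0"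
      using gram normal assms(1) mink_commute
      by (simp add: forall_4 normal_plane_iff orthogonal_chart_def fund_F_def)
    then show "mink (?A (s *\<^sub>R m2) $ i) (?A (s *\<^sub>R m2) $ j) = 0" if "i \<noteq> j" for i j
      using that by blast
    have "\<forall>i. mink (?A (s *\<^sub>R m2) $ i) (?A (s *\<^sub>R m2) $ i) \<noteq> 0"
      using gram assms(1) by (simp add: forall_4 orthogonal_chart_def fund_E_def fund_G_def)
    then show "mink (?A (s *\<^sub>R m2) $ i) (?A (s *\<^sub>R m2) $ i) \<noteq> 0" for i by blast
  qed
  moreover have "det (?A (- (s *\<^sub>R m2))) = - det (?A (s *\<^sub>R m2))"
  proof -
    \<comment> \<open>The matrix is put in the form with one scaled row, to which the multilinearity
      of the determinant applies.\<close>
    have 1: "?A (- (s *\<^sub>R m2)) = (\<chi> i. if i = 4 then (-1) *s (s *\<^sub>R m2) else ?A (s *\<^sub>R m2) $ i)"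
      by (rule vec4_eqI) (simp_all add: vec_eq_iff)
    have 2: "?A (s *\<^sub>R m2) = (\<chi> i. if i = 4 then s *\<^sub>R m2 else ?A (s *\<^sub>R m2) $ i)"
      by (rule vec4_eqI) simp_all
    show ?thesis
      unfolding 1 by (subst (2) 2) (simp only: det_row_mul)
  qed
  ultimately have "det (?A (s *\<^sub>R m2)) > 0 \<or> det (?A ((- s) *\<^sub>R m2)) > 0" by auto
  then show ?thesis
  proof
    assume "det (?A (s *\<^sub>R m2)) > 0"
    then show ?thesis using gram normal unfolding normal_frame_def by blast
  next
    assume "det (?A ((- s) *\<^sub>R m2)) > 0"
    then have "normal_frame z p (r *\<^sub>R m1) ((- s) *\<^sub>R m2)"
      using gram normal unfolding normal_frame_def
      by (simp add: normal_plane_iff mink.minus_left mink.minus_right)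
    then show ?thesis by blast
  qed
qed

section \<open>Calculus of fields expanded in a moving frame\<close>

lemma du_cong_open:
  assumes "open V" "q \<in> V" "smooth_on k V" "\<And>y. y \<in> V \<Longrightarrow> h y = k y"
  shows "du h q = du k q" "dv h q = dv k q"
  using frechet_derivative_cong_open(2)[OF assms(1,2,4) smooth_on_imp_differentiable_on[OF assms(3)]]
  by (simp_all add: du_def dv_def)

text \<open>The linear combinations of \<open>e\<close> and \<open>e'\<close> with constant
  coefficients are closed under differentiation. The circular pair is the case
  \<open>r = \<alpha>\<close>, \<open>s = - \<alpha>\<close>, the hyperbolic pair the case
  \<open>r = s = \<beta>\<close>.\<close>

lemma smooth_on_linear_ode:
  fixes e e' :: "real \<Rightarrow> 'b::euclidean_space"
  assumes "\<And>v. (e has_vector_derivative r *\<^sub>R e' v) (at v)"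
    and "\<And>v. (e' has_vector_derivative s *\<^sub>R e v) (at v)"
  shows "smooth_on e UNIV" "smooth_on e' UNIV"
proof -
  have "smooth_on (\<lambda>v. a *\<^sub>R e v + b *\<^sub>R e' v) UNIV" for a b
  proof (rule smooth_on_real_family[where K = "{\<lambda>v. a *\<^sub>R e v + b *\<^sub>R e' v |a b. True}"])
    fix k assume "k \<in> {\<lambda>v. a *\<^sub>R e v + b *\<^sub>R e' v |a b. True}"
    then obtain a b where k: "k = (\<lambda>v. a *\<^sub>R e v + b *\<^sub>R e' v)" by blast
    have "(k has_vector_derivative (s * b) *\<^sub>R e v + (r * a) *\<^sub>R e' v) (at v)" for v
      unfolding k by (rule derivative_eq_intros refl assms)+ (simp add: algebra_simps)
    then show "\<exists>k'\<in>{\<lambda>v. a *\<^sub>R e v + b *\<^sub>R e' v |a b. True}. \<forall>v. (k has_vector_derivative k' v) (at v)"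
      by (intro bexI[of _ "\<lambda>v. (s * b) *\<^sub>R e v + (r * a) *\<^sub>R e' v"]) blast+
    show "(\<lambda>v. c *\<^sub>R k v) \<in> {\<lambda>v. a *\<^sub>R e v + b *\<^sub>R e' v |a b. True}" for c
      unfolding k scaleR_add_right scaleR_scaleR by blast
  qed blast
  from this[of 1 0] this[of 0 1] show "smooth_on e UNIV" "smooth_on e' UNIV" by simp_all
qed

text \<open>
  The moving frame of a rotational surface; \<open>\<epsilon> = 1\<close> gives the first type and \<open>\<epsilon> = -1\<close> the second,
  the two hyperbolic frame vectors being exchanged.
\<close>

locale rotational_frame =
  fixes \<alpha> \<beta> \<epsilon> :: real and e1 e2 e3 e4 :: "real \<Rightarrow> real^4"
  assumes sign: "\<epsilon> = 1 \<or> \<epsilon> = -1"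
    and D1: "\<And>v. (e1 has_vector_derivative \<alpha> *\<^sub>R e2 v) (at v)"
    and D2: "\<And>v. (e2 has_vector_derivative (- \<alpha>) *\<^sub>R e1 v) (at v)"
    and D3: "\<And>v. (e3 has_vector_derivative \<beta> *\<^sub>R e4 v) (at v)"
    and D4: "\<And>v. (e4 has_vector_derivative \<beta> *\<^sub>R e3 v) (at v)"
    and gram: "\<And>v. mink (e1 v) (e1 v) = 1" "\<And>v. mink (e2 v) (e2 v) = 1"
      "\<And>v. mink (e3 v) (e3 v) = \<epsilon>" "\<And>v. mink (e4 v) (e4 v) = - \<epsilon>"
      "\<And>v. mink (e1 v) (e2 v) = 0" "\<And>v. mink (e1 v) (e3 v) = 0" "\<And>v. mink (e1 v) (e4 v) = 0"
      "\<And>v. mink (e2 v) (e3 v) = 0" "\<And>v. mink (e2 v) (e4 v) = 0" "\<And>v. mink (e3 v) (e4 v) = 0"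
begin

definition frame_vec :: "real \<Rightarrow> real \<Rightarrow> real \<Rightarrow> real \<Rightarrow> real \<Rightarrow> real^4" where
  "frame_vec a b c d v = a *\<^sub>R e1 v + b *\<^sub>R e2 v + c *\<^sub>R e3 v + d *\<^sub>R e4 v"

text \<open>Fields whose frame coefficients depend on \<open>u\<close> alone are closed under both
  partial derivatives: \<open>du\<close> differentiates the coefficients, and \<open>dv\<close> acts
  on them by the constant matrix of the frame equations. All later computations thus become
  identities between real functions of \<open>u\<close>.\<close>

definition frame_field ::
    "(real \<Rightarrow> real) \<Rightarrow> (real \<Rightarrow> real) \<Rightarrow> (real \<Rightarrow> real) \<Rightarrow> (real \<Rightarrow> real) \<Rightarrow> real \<times> real \<Rightarrow> real^4" where
  "frame_field a b c d = (\<lambda>(u, v). frame_vec (a u) (b u) (c u) (d u) v)"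

lemma frame_vec_add:
  "frame_vec a b c d v + frame_vec a' b' c' d' v = frame_vec (a + a') (b + b') (c + c') (d + d') v"
  by (simp add: frame_vec_def algebra_simps)

lemma frame_vec_scaleR: "r *\<^sub>R frame_vec a b c d v = frame_vec (r * a) (r * b) (r * c) (r * d) v"
  by (simp add: frame_vec_def algebra_simps)

lemma mink_frame_vec:
  "mink (frame_vec a b c d v) (frame_vec a' b' c' d' v) = a * a' + b * b' + \<epsilon> * (c * c' - d * d')"
  using gram[of v] mink_commute[of "e2 v" "e1 v"] mink_commute[of "e3 v" "e1 v"]
    mink_commute[of "e4 v" "e1 v"] mink_commute[of "e3 v" "e2 v"] mink_commute[of "e4 v" "e2 v"]
    mink_commute[of "e4 v" "e3 v"]
  by (simp add: frame_vec_def mink.add_left mink.add_right mink.scaleR_left mink.scaleR_right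
      algebra_simps)

lemma smooth_frame_field:
  assumes "open J" "smooth_on a J" "smooth_on b J" "smooth_on c J" "smooth_on d J"
  shows "smooth_on (frame_field a b c d) (J \<times> UNIV)"
proof -
  have prod: "smooth_on (\<lambda>q. h (fst q) *\<^sub>R e (snd q)) (J \<times> UNIV)"
    if "smooth_on h J" "smooth_on e UNIV" for h :: "real \<Rightarrow> real" and e :: "real \<Rightarrow> real^4"
    by (rule smooth_on_bilinear[OF smooth_on_compose_linear[OF that(1) assms(1) _ bounded_linear_fst]
          smooth_on_compose_linear[OF that(2) open_UNIV _ bounded_linear_snd] _ bounded_bilinear_scaleR])
      (auto intro: open_Times assms(1))
  show ?thesis
    unfolding frame_field_def frame_vec_def case_prod_beta
    by (intro smooth_on_add prod assms open_Times open_UNIV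
        smooth_on_linear_ode[OF D1 D2] smooth_on_linear_ode[OF D3 D4])
qed

lemma frame_field_derivatives:
  assumes "(a has_real_derivative a') (at u)" "(b has_real_derivative b') (at u)"
    "(c has_real_derivative c') (at u)" "(d has_real_derivative d') (at u)"
  shows "du (frame_field a b c d) (u, v) = frame_vec a' b' c' d' v"
    and "dv (frame_field a b c d) (u, v) =
      frame_vec (- \<alpha> * b u) (\<alpha> * a u) (\<beta> * d u) (\<beta> * c u) v"
proof -
  have prod: "((\<lambda>q. h (fst q) *\<^sub>R e (snd q)) has_derivative
      (\<lambda>x. h u *\<^sub>R snd x *\<^sub>R e' + (fst x * h') *\<^sub>R e v)) (at (u, v))"
    if "(h has_real_derivative h') (at u)" "(e has_vector_derivative e') (at v)"
    for h h' and e :: "real \<Rightarrow> real^4" and e'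
  proof -
    have "(*) h' = (\<lambda>x. x * h')" by (simp add: fun_eq_iff)
    then have h: "(h has_derivative (\<lambda>x. x * h')) (at (fst (u, v)))"
      using that(1) by (simp add: has_field_derivative_def)
    have e: "(e has_derivative (\<lambda>x. x *\<^sub>R e')) (at (snd (u, v)))"
      using that(2) by (simp add: has_vector_derivative_def)
    show ?thesis
      using has_derivative_scaleR[OF
          has_derivative_compose[OF bounded_linear_imp_has_derivative[OF bounded_linear_fst] h]
          has_derivative_compose[OF bounded_linear_imp_has_derivative[OF bounded_linear_snd] e]]
      by simp
  qed
  have "(frame_field a b c d has_derivative (\<lambda>x.
      (a u *\<^sub>R snd x *\<^sub>R (\<alpha> *\<^sub>R e2 v) + (fst x * a') *\<^sub>R e1 v)
      + (b u *\<^sub>R snd x *\<^sub>R ((- \<alpha>) *\<^sub>R e1 v) + (fst x * b') *\<^sub>R e2 v)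
      + (c u *\<^sub>R snd x *\<^sub>R (\<beta> *\<^sub>R e4 v) + (fst x * c') *\<^sub>R e3 v)
      + (d u *\<^sub>R snd x *\<^sub>R (\<beta> *\<^sub>R e3 v) + (fst x * d') *\<^sub>R e4 v))) (at (u, v))"
    unfolding frame_field_def frame_vec_def case_prod_beta
    by (intro has_derivative_add prod assms D1 D2 D3 D4)
  note D = frechet_derivative_at[OF this, symmetric]
  show "du (frame_field a b c d) (u, v) = frame_vec a' b' c' d' v"
    and "dv (frame_field a b c d) (u, v) =
      frame_vec (- \<alpha> * b u) (\<alpha> * a u) (\<beta> * d u) (\<beta> * c u) v"
    unfolding du_def dv_def D frame_vec_def by (simp_all add: algebra_simps)
qed

end

section \<open>Second fundamental form and normal curvature of a rotational surface\<close>

locale rotational_surface = rotational_frame +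
  fixes J :: "real set" and f g :: "real \<Rightarrow> real"
  assumes J: "open J" and f: "smooth_on f J" and g: "smooth_on g J"
    and E_pos: "\<And>u. u \<in> J \<Longrightarrow> (deriv f u)\<^sup>2 + \<epsilon> * (deriv g u)\<^sup>2 > 0"
    and G_pos: "\<And>u. u \<in> J \<Longrightarrow> \<alpha>\<^sup>2 * (f u)\<^sup>2 - \<epsilon> * (\<beta>\<^sup>2 * (g u)\<^sup>2) > 0"
begin

abbreviation z :: "real \<times> real \<Rightarrow> real^4" where
  "z \<equiv> frame_field f (\<lambda>_. 0) g (\<lambda>_. 0)"

text \<open>The vector orthogonal to \<open>z_u\<close> in the plane of \<open>e1\<close> and
  \<open>e3\<close>; its companion \<open>m2\<close> is the vector orthogonal to \<open>z_v\<close>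
  in the plane of \<open>e2\<close> and \<open>e4\<close>. One of them is spacelike and the other
  timelike, and \<epsilon> decides which.\<close>

abbreviation (input) m1 :: "real \<times> real \<Rightarrow> real^4" where
  "m1 \<equiv> frame_field (deriv g) (\<lambda>_. 0) (\<lambda>u. - (\<epsilon> * deriv f u)) (\<lambda>_. 0)"

abbreviation (input) m2 :: "real \<times> real \<Rightarrow> real^4" where
  "m2 \<equiv> frame_field (\<lambda>_. 0) (\<lambda>u. \<beta> * g u) (\<lambda>_. 0) (\<lambda>u. \<epsilon> * \<alpha> * f u)"

lemma frame_field_apply: "frame_field a b c d (u, v) = frame_vec (a u) (b u) (c u) (d u) v"
  by (simp add: frame_field_def)

lemma open_domain: "open (J \<times> (UNIV :: real set))"
  by (intro open_Times J open_UNIV)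

lemma smooth_scale: "smooth_on h J \<Longrightarrow> smooth_on (\<lambda>u. c * h u :: real) J"
  by (rule smooth_on_linear_compose[OF _ J bounded_linear_mult_right])

lemma smooth_z: "smooth_on z (J \<times> UNIV)"
  by (intro smooth_frame_field J f g smooth_on_const)

lemma smooth_m2: "smooth_on m2 (J \<times> UNIV)"
  by (intro smooth_frame_field J f g smooth_on_const smooth_scale)

lemmas Df = smooth_on_deriv(2)[OF f J] and Dg = smooth_on_deriv(2)[OF g J]
  and DDf = smooth_on_deriv(2)[OF smooth_on_deriv(1)[OF f J] J]
  and DDg = smooth_on_deriv(2)[OF smooth_on_deriv(1)[OF g J] J]

lemma first_derivatives:
  assumes "u \<in> J"
  shows "du z (u, v) = frame_vec (deriv f u) 0 (deriv g u) 0 v"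
    and "dv z (u, v) = frame_vec 0 (\<alpha> * f u) 0 (\<beta> * g u) v"
  using frame_field_derivatives[OF Df[OF assms] DERIV_const[of 0] Dg[OF assms] DERIV_const[of 0], of v]
  by simp_all

lemma second_derivatives:
  assumes u: "u \<in> J"
  shows "du (du z) (u, v) = frame_vec (deriv (deriv f) u) 0 (deriv (deriv g) u) 0 v"
    and "dv (du z) (u, v) = frame_vec 0 (\<alpha> * deriv f u) 0 (\<beta> * deriv g u) v"
    and "dv (dv z) (u, v) = frame_vec (- \<alpha>\<^sup>2 * f u) 0 (\<beta>\<^sup>2 * g u) 0 v"
proof -
  let ?zu = "frame_field (deriv f) (\<lambda>_. 0) (deriv g) (\<lambda>_. 0)"
  let ?zv = "frame_field (\<lambda>_. 0) (\<lambda>u. \<alpha> * f u) (\<lambda>_. 0) (\<lambda>u. \<beta> * g u)"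
  have q: "(u, v) \<in> J \<times> UNIV" using u by simp
  have su: "smooth_on ?zu (J \<times> UNIV)"
    by (intro smooth_frame_field J f g smooth_on_const smooth_on_deriv(1))
  have sv: "smooth_on ?zv (J \<times> UNIV)"
    by (intro smooth_frame_field J f g smooth_on_const smooth_scale)
  \<comment> \<open>The first derivatives are identified with frame fields on the whole open domain,
    not just at one point, so that they may be differentiated once more.\<close>
  have eq_u: "du z y = ?zu y" and eq_v: "dv z y = ?zv y" if "y \<in> J \<times> UNIV" for y
    using that by (auto simp: first_derivatives frame_field_apply)
  note Fu = frame_field_derivatives[OF DDf[OF u] DERIV_const[of 0] DDg[OF u] DERIV_const[of 0], of v]
  note Fv = frame_field_derivatives[OF DERIV_const[of 0] DERIV_cmult[OF Df[OF u], of \<alpha>]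
      DERIV_const[of 0] DERIV_cmult[OF Dg[OF u], of \<beta>], of v]
  show "du (du z) (u, v) = frame_vec (deriv (deriv f) u) 0 (deriv (deriv g) u) 0 v"
    using du_cong_open(1)[OF open_domain q su eq_u] Fu by simp
  show "dv (du z) (u, v) = frame_vec 0 (\<alpha> * deriv f u) 0 (\<beta> * deriv g u) v"
    using du_cong_open(2)[OF open_domain q su eq_u] Fu by simp
  show "dv (dv z) (u, v) = frame_vec (- \<alpha>\<^sup>2 * f u) 0 (\<beta>\<^sup>2 * g u) 0 v"
    using du_cong_open(2)[OF open_domain q sv eq_v] Fv by (simp add: power2_eq_square mult.assoc)
qed

text \<open>Here \<open>z_u\<close> lies in the plane of \<open>e1\<close> and \<open>e3\<close> and
  \<open>z_v\<close> in that of \<open>e2\<close> and \<open>e4\<close>, which makes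
  \<open>F\<close> vanish. The locale assumptions \<open>E_pos\<close> and \<open>G_pos\<close> are
  the positivity of the other two values.\<close>

lemma fundamental_forms:
  assumes "u \<in> J"
  shows "fund_E z (u, v) = (deriv f u)\<^sup>2 + \<epsilon> * (deriv g u)\<^sup>2"
    and "fund_F z (u, v) = 0"
    and "fund_G z (u, v) = \<alpha>\<^sup>2 * (f u)\<^sup>2 - \<epsilon> * (\<beta>\<^sup>2 * (g u)\<^sup>2)"
  using assms
  by (simp_all add: fund_E_def fund_F_def fund_G_def first_derivatives mink_frame_vec
      power2_eq_square algebra_simps)

lemma orthogonal_chart_z: "q \<in> J \<times> UNIV \<Longrightarrow> orthogonal_chart z q"
  using E_pos G_pos by (auto simp: orthogonal_chart_def fundamental_forms)

lemma sign_square: "\<epsilon> * \<epsilon> = 1"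
  using sign by auto

lemma normal_m:
  assumes "q \<in> J \<times> UNIV"
  shows "m1 q \<in> normal_plane z q" "m2 q \<in> normal_plane z q"
  using assms sign
  by (auto simp: normal_plane_iff first_derivatives frame_field_apply mink_frame_vec)

lemma mink_m:
  assumes "u \<in> J"
  shows "mink (m1 (u, v)) (m1 (u, v)) = \<epsilon> * fund_E z (u, v)"
    and "mink (m2 (u, v)) (m2 (u, v)) = - \<epsilon> * fund_G z (u, v)"
    and "mink (m1 (u, v)) (m2 (u, v)) = 0"
  using assms sign
  by (auto simp: frame_field_apply mink_frame_vec fundamental_forms power2_eq_square algebra_simps)

text \<open>The product of \<open>z_uu\<close> with \<open>m1\<close>. Likewise
  \<open>coeff_vv\<close> is minus the product of \<open>z_vv\<close> with \<open>m1\<close>, and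
  \<open>coeff_uv\<close> is minus that of \<open>z_uv\<close> with \<open>m2\<close>. The signs
  make \<open>coeff_uu\<close> and \<open>coeff_vv\<close> the numerators of the asserted
  equation.\<close>

definition coeff_uu :: "real \<Rightarrow> real" where
  "coeff_uu u = deriv g u * deriv (deriv f) u - deriv f u * deriv (deriv g) u"

definition coeff_vv :: "real \<Rightarrow> real" where
  "coeff_vv u = \<alpha>\<^sup>2 * f u * deriv g u + \<beta>\<^sup>2 * g u * deriv f u"

definition coeff_uv :: "real \<Rightarrow> real" where
  "coeff_uv u = \<alpha> * \<beta> * (f u * deriv g u - g u * deriv f u)"

text \<open>Both \<open>z_uu\<close> and \<open>z_vv\<close> lie in the plane of \<open>e1\<close>
  and \<open>e3\<close>, spanned by \<open>z_u\<close> and \<open>m1\<close>, while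
  \<open>z_uv\<close> lies in the plane of \<open>e2\<close> and \<open>e4\<close>, spanned by
  \<open>z_v\<close> and \<open>m2\<close>. Expanding in these orthogonal bases displays the normal
  parts.\<close>

lemma normal_components:
  assumes u: "u \<in> J"
  shows "normal_component z (u, v) (du (du z) (u, v)) = (\<epsilon> * coeff_uu u / fund_E z (u, v)) *\<^sub>R m1 (u, v)"
    and "normal_component z (u, v) (dv (dv z) (u, v)) = (- \<epsilon> * coeff_vv u / fund_E z (u, v)) *\<^sub>R m1 (u, v)"
    and "normal_component z (u, v) (dv (du z) (u, v)) = (\<epsilon> * coeff_uv u / fund_G z (u, v)) *\<^sub>R m2 (u, v)"
proof -
  let ?E = "fund_E z (u, v)" and ?G = "fund_G z (u, v)"
  have q: "(u, v) \<in> J \<times> UNIV" using u by simp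
  have E: "?E \<noteq> 0" and G: "?G \<noteq> 0"
    using orthogonal_chart_z[OF q] by (auto simp: orthogonal_chart_def)
  note forms = fundamental_forms[OF u, of v]
  note component = normal_component_eqI[OF orthogonal_chart_z[OF q]]
  have normal: "x *\<^sub>R m1 (u, v) \<in> normal_plane z (u, v)" "x *\<^sub>R m2 (u, v) \<in> normal_plane z (u, v)" for x
    using normal_m[OF q] by (simp_all add: normal_plane_iff mink.scaleR_left)
  \<comment> \<open>Clears the common denominator, so that each coordinate of an expansion becomes a
    polynomial identity modulo \<open>\<epsilon> * \<epsilon> = 1\<close>.\<close>
  have divide_form: "x = a / r * y + b / r * w" if "r \<noteq> 0" "x * r = a * y + b * w" for x r a y b w :: real
    using that by (simp add: field_simps)
  \<comment> \<open>The tangential coefficient \<open>mink z_uu z_u / E\<close>; below,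
    \<open>b\<close> is \<open>mink z_vv z_u / E\<close> and \<open>c\<close> is
    \<open>mink z_uv z_v / G\<close>.\<close>
  define a where "a = (deriv f u * deriv (deriv f) u + \<epsilon> * deriv g u * deriv (deriv g) u) / ?E"
  have "du (du z) (u, v) = a *\<^sub>R du z (u, v) + 0 *\<^sub>R dv z (u, v) + (\<epsilon> * coeff_uu u / ?E) *\<^sub>R m1 (u, v)"
  proof -
    have "deriv (deriv f) u = a * deriv f u + \<epsilon> * coeff_uu u / ?E * deriv g u"
      unfolding a_def by (rule divide_form[OF E], unfold forms coeff_uu_def) algebra
    moreover have "deriv (deriv g) u = a * deriv g u + \<epsilon> * coeff_uu u / ?E * (- (\<epsilon> * deriv f u))"
      unfolding a_def
      by (rule divide_form[OF E], unfold forms coeff_uu_def, use sign_square in algebra)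
    ultimately show ?thesis
      by (simp add: second_derivatives first_derivatives frame_field_apply frame_vec_scaleR
          frame_vec_add u)
  qed
  then show "normal_component z (u, v) (du (du z) (u, v)) = (\<epsilon> * coeff_uu u / ?E) *\<^sub>R m1 (u, v)"
    by (simp only: component[OF normal(1)])
  define b where "b = (- \<alpha>\<^sup>2 * f u * deriv f u + \<epsilon> * \<beta>\<^sup>2 * g u * deriv g u) / ?E"
  have "dv (dv z) (u, v) = b *\<^sub>R du z (u, v) + 0 *\<^sub>R dv z (u, v) + (- \<epsilon> * coeff_vv u / ?E) *\<^sub>R m1 (u, v)"
  proof -
    have "- \<alpha>\<^sup>2 * f u = b * deriv f u + - \<epsilon> * coeff_vv u / ?E * deriv g u"
      unfolding b_def by (rule divide_form[OF E], unfold forms coeff_vv_def) algebra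
    moreover have "\<beta>\<^sup>2 * g u = b * deriv g u + - \<epsilon> * coeff_vv u / ?E * (- (\<epsilon> * deriv f u))"
      unfolding b_def
      by (rule divide_form[OF E], unfold forms coeff_vv_def, use sign_square in algebra)
    ultimately show ?thesis
      by (simp add: second_derivatives first_derivatives frame_field_apply frame_vec_scaleR
          frame_vec_add u)
  qed
  then show "normal_component z (u, v) (dv (dv z) (u, v)) = (- \<epsilon> * coeff_vv u / ?E) *\<^sub>R m1 (u, v)"
    by (simp only: component[OF normal(1)])
  define c where "c = (\<alpha>\<^sup>2 * f u * deriv f u - \<epsilon> * \<beta>\<^sup>2 * g u * deriv g u) / ?G"
  have "dv (du z) (u, v) = 0 *\<^sub>R du z (u, v) + c *\<^sub>R dv z (u, v) + (\<epsilon> * coeff_uv u / ?G) *\<^sub>R m2 (u, v)"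
  proof -
    have "\<alpha> * deriv f u = c * (\<alpha> * f u) + \<epsilon> * coeff_uv u / ?G * (\<beta> * g u)"
      unfolding c_def by (rule divide_form[OF G], unfold forms coeff_uv_def) algebra
    moreover have "\<beta> * deriv g u = c * (\<beta> * g u) + \<epsilon> * coeff_uv u / ?G * (\<epsilon> * \<alpha> * f u)"
      unfolding c_def
      by (rule divide_form[OF G], unfold forms coeff_uv_def, use sign_square in algebra)
    ultimately show ?thesis
      by (simp add: second_derivatives first_derivatives frame_field_apply frame_vec_scaleR
          frame_vec_add u)
  qed
  then show "normal_component z (u, v) (dv (du z) (u, v)) = (\<epsilon> * coeff_uv u / ?G) *\<^sub>R m2 (u, v)"
    by (simp only: component[OF normal(2)])
qed

lemma second_form_normal:
  assumes u: "u \<in> J" and n: "n \<in> normal_plane z (u, v)"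
  shows "c11 z (u, v) n = \<epsilon> * coeff_uu u / fund_E z (u, v) * mink (m1 (u, v)) n"
    and "c12 z (u, v) n = \<epsilon> * coeff_uv u / fund_G z (u, v) * mink (m2 (u, v)) n"
    and "c22 z (u, v) n = - \<epsilon> * coeff_vv u / fund_E z (u, v) * mink (m1 (u, v)) n"
proof -
  have "orthogonal_chart z (u, v)" using u by (intro orthogonal_chart_z) simp
  note N = mink_normal_component[OF this n]
  show "c11 z (u, v) n = \<epsilon> * coeff_uu u / fund_E z (u, v) * mink (m1 (u, v)) n"
    using N[of "du (du z) (u, v)"] unfolding normal_components[OF u] c11_def mink.scaleR_left by simp
  show "c12 z (u, v) n = \<epsilon> * coeff_uv u / fund_G z (u, v) * mink (m2 (u, v)) n"
    using N[of "dv (du z) (u, v)"] unfolding normal_components[OF u] c12_def mink.scaleR_left by simp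
  show "c22 z (u, v) n = - \<epsilon> * coeff_vv u / fund_E z (u, v) * mink (m1 (u, v)) n"
    using N[of "dv (dv z) (u, v)"] unfolding normal_components[OF u] c22_def mink.scaleR_left by simp
qed

text \<open>In the Ricci formula the \<open>m1\<close> part collects the terms with
  \<open>c12\<close>, and the \<open>m2\<close> part those with \<open>c11\<close> and
  \<open>c22\<close>. Both carry the same scalar with opposite signs, since each is a product of the
  \<open>z_uv\<close> coefficient with the same combination of the other two; the factors \<epsilon>
  occur in pairs and cancel.\<close>

lemma normal_curvature_z:
  assumes "smooth_on \<xi> V" "smooth_on X1 V" "smooth_on X2 V" "open V" "(u, v) \<in> V"
    and V: "V \<subseteq> J \<times> UNIV"
    and normal: "\<forall>q\<in>V. \<xi> q \<in> normal_plane z q"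
  shows "normal_curvature z X1 X2 \<xi> (u, v) =
    ((fst (X1 (u, v)) * snd (X2 (u, v)) - snd (X1 (u, v)) * fst (X2 (u, v))) *
      (coeff_uv u / (fund_E z (u, v) * fund_G z (u, v))) *
      (coeff_uu u / fund_E z (u, v) + coeff_vv u / fund_G z (u, v))) *\<^sub>R
      (mink (m2 (u, v)) (\<xi> (u, v)) *\<^sub>R m1 (u, v) - mink (m1 (u, v)) (\<xi> (u, v)) *\<^sub>R m2 (u, v))"
proof -
  let ?E = "fund_E z (u, v)" and ?G = "fund_G z (u, v)"
  let ?w = "fst (X1 (u, v)) * snd (X2 (u, v)) - snd (X1 (u, v)) * fst (X2 (u, v))"
  have u: "u \<in> J" using assms(5) V by auto
  have n: "\<xi> (u, v) \<in> normal_plane z (u, v)" using normal assms(5) by blast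
  have chart: "\<forall>q\<in>V. orthogonal_chart z q" using V orthogonal_chart_z by blast
  note K = normal_curvature_Ricci[OF smooth_on_subset[OF smooth_z V] assms(1-5) chart normal]
  define x where "x = mink (m1 (u, v)) (\<xi> (u, v))"
  define y where "y = mink (m2 (u, v)) (\<xi> (u, v))"
  let ?k = "coeff_uv u / (?E * ?G) * (coeff_uu u / ?E + coeff_vv u / ?G)"
  have 1: "\<epsilon> * coeff_uv u / ?G * y / ?E * (\<epsilon> * coeff_uu u / ?E)
      - \<epsilon> * coeff_uv u / ?G * y / ?G * (- \<epsilon> * coeff_vv u / ?E) = ?k * y"
  proof -
    have "\<epsilon> * coeff_uv u / ?G * y / ?E * (\<epsilon> * coeff_uu u / ?E)
      - \<epsilon> * coeff_uv u / ?G * y / ?G * (- \<epsilon> * coeff_vv u / ?E) = (\<epsilon> * \<epsilon>) * (?k * y)"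
      by (simp add: algebra_simps add_divide_distrib)
    then show ?thesis by (simp only: sign_square mult_1)
  qed
  have 2: "- \<epsilon> * coeff_vv u / ?E * x / ?G * (\<epsilon> * coeff_uv u / ?G)
      - \<epsilon> * coeff_uu u / ?E * x / ?E * (\<epsilon> * coeff_uv u / ?G) = - (?k * x)"
  proof -
    have "- \<epsilon> * coeff_vv u / ?E * x / ?G * (\<epsilon> * coeff_uv u / ?G)
      - \<epsilon> * coeff_uu u / ?E * x / ?E * (\<epsilon> * coeff_uv u / ?G) = - ((\<epsilon> * \<epsilon>) * (?k * x))"
      by (simp add: algebra_simps add_divide_distrib)
    then show ?thesis by (simp only: sign_square mult_1)
  qed
  have collect: "a *\<^sub>R r *\<^sub>R m - b *\<^sub>R s *\<^sub>R n + c *\<^sub>R s *\<^sub>R n - d *\<^sub>R t *\<^sub>R m =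
      (a * r - d * t) *\<^sub>R m + (c * s - b * s) *\<^sub>R n" for a b c d r s t and m n :: "real^4"
    by (simp add: algebra_simps)
  have factor: "w *\<^sub>R ((k * y) *\<^sub>R m + (- (k * x)) *\<^sub>R n) = (w * k) *\<^sub>R (y *\<^sub>R m - x *\<^sub>R n)"
    for w k and m n :: "real^4"
    by (simp add: algebra_simps)
  show ?thesis
    unfolding K second_form_normal[OF u n] normal_components[OF u]
    unfolding x_def[symmetric] y_def[symmetric] collect 1 2 factor
    by (simp only: mult.assoc)
qed

text \<open>If \<open>coeff_uv\<close> vanishes, so does \<open>c12\<close> on normal vectors, and
  with it \<open>L\<close> and \<open>N\<close>. \<open>M\<close> is zero because \<open>c11\<close>
  and \<open>c22\<close> are both multiples of the product with \<open>m1\<close>. The frame starts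
  with the spacelike one of \<open>m1\<close> and \<open>m2\<close>, hence the case split on
  \<epsilon>.\<close>

lemma flat_point_z:
  assumes u: "u \<in> J" and "coeff_uv u = 0"
  shows "flat_point z (u, v)"
proof -
  have q: "(u, v) \<in> J \<times> UNIV" using u by simp
  note chart = orthogonal_chart_z[OF q] and normal = normal_m[OF q] and mm = mink_m[OF u, of v]
  have pos: "fund_E z (u, v) > 0" "fund_G z (u, v) > 0"
    using chart by (auto simp: orthogonal_chart_def)
  have normal_scaled: "r *\<^sub>R n \<in> normal_plane z (u, v)" if "n \<in> normal_plane z (u, v)" for r n
    using that by (simp add: normal_plane_iff mink.scaleR_left)
  note forms = second_form_normal[OF u normal_scaled[OF normal(1)]]
    second_form_normal[OF u normal_scaled[OF normal(2)]]
  show ?thesis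
    using sign
  proof
    assume e: "\<epsilon> = 1"
    obtain r s where "normal_frame z (u, v) (r *\<^sub>R m1 (u, v)) (s *\<^sub>R m2 (u, v))"
      using normal_frame_exists[OF chart normal] mm pos e by auto
    then show ?thesis
      unfolding flat_point_def coeff_L_def coeff_M_def coeff_N_def
      by (intro exI conjI, assumption) (simp_all add: forms assms(2) mink.scaleR_right mm)
  next
    assume e: "\<epsilon> = -1"
    obtain r s where "normal_frame z (u, v) (r *\<^sub>R m2 (u, v)) (s *\<^sub>R m1 (u, v))"
      using normal_frame_exists[OF chart normal(2,1)] mm pos e
        mink_commute[of "m2 (u, v)" "m1 (u, v)"] by auto
    then show ?thesis
      unfolding flat_point_def coeff_L_def coeff_M_def coeff_N_def
      by (intro exI conjI, assumption) (simp_all add: forms assms(2) mink.scaleR_right mm)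
  qed
qed

lemma flat_normal_connection_iff:
  assumes free: "free_of_flat_points z (J \<times> {0..<2 * pi})"
  shows "flat_normal_connection z (J \<times> {0..<2 * pi}) \<longleftrightarrow>
    (\<forall>u\<in>J. coeff_uu u / ((deriv f u)\<^sup>2 + \<epsilon> * (deriv g u)\<^sup>2) =
      - (coeff_vv u / (\<alpha>\<^sup>2 * (f u)\<^sup>2 - \<epsilon> * (\<beta>\<^sup>2 * (g u)\<^sup>2))))"
proof
  assume flat: "flat_normal_connection z (J \<times> {0..<2 * pi})"
  show "\<forall>u\<in>J. coeff_uu u / ((deriv f u)\<^sup>2 + \<epsilon> * (deriv g u)\<^sup>2) =
      - (coeff_vv u / (\<alpha>\<^sup>2 * (f u)\<^sup>2 - \<epsilon> * (\<beta>\<^sup>2 * (g u)\<^sup>2)))"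
  proof
    fix u assume u: "u \<in> J"
    \<comment> \<open>The asserted equation involves only \<open>u\<close>, so one point on each
      parameter circle suffices; \<open>v = 0\<close> belongs to the half-open interval.\<close>
    have p: "(u, 0) \<in> J \<times> {0..<2 * pi}" "(u, 0) \<in> J \<times> (UNIV :: real set)" using u by auto
    have E: "fund_E z (u, 0) > 0" "fund_G z (u, 0) > 0"
      using orthogonal_chart_z[OF p(2)] by (auto simp: orthogonal_chart_def)
    have S: "coeff_uv u \<noteq> 0"
      using free p(1) flat_point_z[OF u, of 0] by (auto simp: free_of_flat_points_def)
    have normal: "\<forall>q\<in>J \<times> UNIV. m2 q \<in> normal_plane z q" using normal_m(2) by blast
    \<comment> \<open>The coordinate fields have determinant 1. With \<open>m2\<close> as normal
      field the curvature is a multiple of \<open>m1\<close> alone, with the nonzero factor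
      \<open>mink m2 m2\<close>.\<close>
    have "normal_curvature z (\<lambda>_. (1, 0)) (\<lambda>_. (0, 1)) m2 (u, 0) = 0"
      using flat[unfolded flat_normal_connection_def, rule_format, OF p(1) open_domain p(2)
          smooth_on_const smooth_on_const smooth_m2] normal by blast
    then have "(coeff_uv u / (fund_E z (u, 0) * fund_G z (u, 0)) *
      (coeff_uu u / fund_E z (u, 0) + coeff_vv u / fund_G z (u, 0)) *
        mink (m2 (u, 0)) (m2 (u, 0))) *\<^sub>R m1 (u, 0) = 0"
      using normal_curvature_z[OF smooth_m2 smooth_on_const smooth_on_const open_domain p(2) subset_refl normal,
          of "(1, 0)" "(0, 1)"] mink_m(3)[OF u, of 0]
      by simp
    moreover have "m1 (u, 0) \<noteq> 0"
      using mink_m(1)[OF u, of 0] E sign by (auto simp: mink.zero_left)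
    moreover have "mink (m2 (u, 0)) (m2 (u, 0)) \<noteq> 0"
      using mink_m(2)[OF u, of 0] E sign by auto
    ultimately have "coeff_uu u / fund_E z (u, 0) + coeff_vv u / fund_G z (u, 0) = 0"
      using E S by simp
    then show "coeff_uu u / ((deriv f u)\<^sup>2 + \<epsilon> * (deriv g u)\<^sup>2) =
      - (coeff_vv u / (\<alpha>\<^sup>2 * (f u)\<^sup>2 - \<epsilon> * (\<beta>\<^sup>2 * (g u)\<^sup>2)))"
      by (simp add: fundamental_forms[OF u])
  qed
next
  assume eq: "\<forall>u\<in>J. coeff_uu u / ((deriv f u)\<^sup>2 + \<epsilon> * (deriv g u)\<^sup>2) =
      - (coeff_vv u / (\<alpha>\<^sup>2 * (f u)\<^sup>2 - \<epsilon> * (\<beta>\<^sup>2 * (g u)\<^sup>2)))"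
  show "flat_normal_connection z (J \<times> {0..<2 * pi})"
    unfolding flat_normal_connection_def
  proof (intro ballI allI impI)
    fix p U and X1 X2 :: "real \<times> real \<Rightarrow> real \<times> real" and \<xi> :: "real \<times> real \<Rightarrow> real^4"
    assume p: "p \<in> J \<times> {0..<2 * pi}" "open U" "p \<in> U"
      and smooth: "smooth_on X1 U" "smooth_on X2 U" "smooth_on \<xi> U"
      and normal: "\<forall>q\<in>U. \<xi> q \<in> normal_plane z q"
    obtain u v where uv: "p = (u, v)" "u \<in> J" using p(1) by auto
    \<comment> \<open>The given neighbourhood may reach beyond \<open>J\<close>, where neither
      smoothness nor an orthogonal chart is available.\<close>
    define V where "V = U \<inter> J \<times> UNIV"
    have V: "open V" "(u, v) \<in> V" "V \<subseteq> U" "V \<subseteq> J \<times> UNIV" "\<forall>q\<in>V. \<xi> q \<in> normal_plane z q"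
      using p uv open_domain normal by (auto simp: V_def)
    have "coeff_uu u / fund_E z (u, v) + coeff_vv u / fund_G z (u, v) = 0"
      using eq uv by (simp add: fundamental_forms)
    then show "normal_curvature z X1 X2 \<xi> p = 0"
      unfolding uv(1) normal_curvature_z[OF smooth_on_subset[OF smooth(3) V(3)]
          smooth_on_subset[OF smooth(1) V(3)] smooth_on_subset[OF smooth(2) V(3)] V(1,2,4,5)]
      by simp
  qed
qed

end

section \<open>The concrete frames of the two types\<close>

lemma has_vector_derivative_vector_4:
  fixes a b c d :: "real \<Rightarrow> real"
  assumes "(a has_real_derivative a') (at v)" "(b has_real_derivative b') (at v)"
    "(c has_real_derivative c') (at v)" "(d has_real_derivative d') (at v)"
  shows "((\<lambda>v. vector [a v, b v, c v, d v] :: real^4) has_vector_derivative vector [a', b', c', d']) (at v)"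
proof -
  have vec: "(vector [a, b, c, d] :: real^4) = a *\<^sub>R axis 1 1 + b *\<^sub>R axis 2 1 + c *\<^sub>R axis 3 1 + d *\<^sub>R axis 4 1"
    for a b c d
    by (rule vec4_eqI) (simp_all add: axis_def)
  show ?thesis
    unfolding vec by (rule derivative_eq_intros refl assms)+ simp
qed

lemma rotational_frame_hyperbolic:
  fixes \<alpha> \<beta> :: real
  shows "rotational_frame \<alpha> \<beta> 1
      (\<lambda>v. vector [cos (\<alpha> * v), sin (\<alpha> * v), 0, 0]) (\<lambda>v. vector [- sin (\<alpha> * v), cos (\<alpha> * v), 0, 0])
      (\<lambda>v. vector [0, 0, cosh (\<beta> * v), sinh (\<beta> * v)]) (\<lambda>v. vector [0, 0, sinh (\<beta> * v), cosh (\<beta> * v)])"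
    and "rotational_frame \<alpha> \<beta> (-1)
      (\<lambda>v. vector [cos (\<alpha> * v), sin (\<alpha> * v), 0, 0]) (\<lambda>v. vector [- sin (\<alpha> * v), cos (\<alpha> * v), 0, 0])
      (\<lambda>v. vector [0, 0, sinh (\<beta> * v), cosh (\<beta> * v)]) (\<lambda>v. vector [0, 0, cosh (\<beta> * v), sinh (\<beta> * v)])"
proof -
  have scale: "r *\<^sub>R (vector [a, b, c, d] :: real^4) = vector [r * a, r * b, r * c, r * d]" for r a b c d
    by (rule vec4_eqI) simp_all
  have hyp: "cosh x * cosh x = 1 + sinh x * sinh x" for x :: real
    using hyperbolic_pythagoras[of x] by (simp add: power2_eq_square)
  have circ: "cos x * cos x = 1 - sin x * sin x" for x :: real
    using sin_cos_squared_add3[of x] by linarith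
  let ?e1 = "\<lambda>v. vector [cos (\<alpha> * v), sin (\<alpha> * v), 0, 0] :: real^4"
    and ?e2 = "\<lambda>v. vector [- sin (\<alpha> * v), cos (\<alpha> * v), 0, 0] :: real^4"
    and ?c = "\<lambda>v. vector [0, 0, cosh (\<beta> * v), sinh (\<beta> * v)] :: real^4"
    and ?s = "\<lambda>v. vector [0, 0, sinh (\<beta> * v), cosh (\<beta> * v)] :: real^4"
  \<comment> \<open>The right-hand sides are written exactly as the coordinates of the scaled frame
    vectors, to be matched by resolution. Hence the cosine occurs twice, once for \<open>e1\<close>
    and once for \<open>e2\<close>, and the zero derivative has the form
    \<open>r * 0\<close>.\<close>
  have trig: "((\<lambda>v. cos (\<alpha> * v)) has_real_derivative \<alpha> * - sin (\<alpha> * v)) (at v)"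
    "((\<lambda>v. sin (\<alpha> * v)) has_real_derivative \<alpha> * cos (\<alpha> * v)) (at v)"
    "((\<lambda>v. - sin (\<alpha> * v)) has_real_derivative - \<alpha> * cos (\<alpha> * v)) (at v)"
    "((\<lambda>v. cos (\<alpha> * v)) has_real_derivative - \<alpha> * sin (\<alpha> * v)) (at v)"
    "((\<lambda>v. cosh (\<beta> * v)) has_real_derivative \<beta> * sinh (\<beta> * v)) (at v)"
    "((\<lambda>v. sinh (\<beta> * v)) has_real_derivative \<beta> * cosh (\<beta> * v)) (at v)" for v
    by (rule derivative_eq_intros refl | simp)+
  have zero: "((\<lambda>v. 0) has_real_derivative r * 0) (at v)" for r v :: real
    by simp
  have D: "(?e1 has_vector_derivative \<alpha> *\<^sub>R ?e2 v) (at v)"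
    "(?e2 has_vector_derivative (- \<alpha>) *\<^sub>R ?e1 v) (at v)"
    "(?c has_vector_derivative \<beta> *\<^sub>R ?s v) (at v)"
    "(?s has_vector_derivative \<beta> *\<^sub>R ?c v) (at v)" for v
    unfolding scale by (rule has_vector_derivative_vector_4 trig zero)+
  show "rotational_frame \<alpha> \<beta> 1 ?e1 ?e2 ?c ?s"
    by (rule rotational_frame.intro; (rule D)?) (simp_all add: mink_def circ hyp)
  show "rotational_frame \<alpha> \<beta> (-1) ?e1 ?e2 ?s ?c"
    by (rule rotational_frame.intro; (rule D)?) (simp_all add: mink_def circ hyp)
qed

theorem theorem3p3:
  fixes \<alpha> \<beta> :: real and J :: "real set" and f g :: "real \<Rightarrow> real"
  assumes "\<alpha> > 0" and "\<beta> > 0"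
    and "open J" and "is_interval J"
    and "smooth_on f J" and "smooth_on g J"
  shows
    "((\<forall>u\<in>J. \<alpha>\<^sup>2 * (f u)\<^sup>2 - \<beta>\<^sup>2 * (g u)\<^sup>2 > 0) \<longrightarrow>
      (\<forall>u\<in>J. (deriv f u)\<^sup>2 + (deriv g u)\<^sup>2 > 0) \<longrightarrow>
      free_of_flat_points (rot_surface1 \<alpha> \<beta> f g) (J \<times> {0..<2*pi}) \<longrightarrow>
      (flat_normal_connection (rot_surface1 \<alpha> \<beta> f g) (J \<times> {0..<2*pi}) \<longleftrightarrow>
       (\<forall>u\<in>J.
          (deriv g u * deriv (deriv f) u - deriv f u * deriv (deriv g) u)
            / ((deriv f u)\<^sup>2 + (deriv g u)\<^sup>2)
          = - ((\<alpha>\<^sup>2 * f u * deriv g u + \<beta>\<^sup>2 * g u * deriv f u)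
               / (\<alpha>\<^sup>2 * (f u)\<^sup>2 - \<beta>\<^sup>2 * (g u)\<^sup>2)))))
     \<and>
     ((\<forall>u\<in>J. (deriv f u)\<^sup>2 - (deriv g u)\<^sup>2 > 0) \<longrightarrow>
      (\<forall>u\<in>J. \<alpha>\<^sup>2 * (f u)\<^sup>2 + \<beta>\<^sup>2 * (g u)\<^sup>2 > 0) \<longrightarrow>
      free_of_flat_points (rot_surface2 \<alpha> \<beta> f g) (J \<times> {0..<2*pi}) \<longrightarrow>
      (flat_normal_connection (rot_surface2 \<alpha> \<beta> f g) (J \<times> {0..<2*pi}) \<longleftrightarrow>
       (\<forall>u\<in>J.
          (deriv g u * deriv (deriv f) u - deriv f u * deriv (deriv g) u)
            / ((deriv f u)\<^sup>2 - (deriv g u)\<^sup>2)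
          = - ((\<alpha>\<^sup>2 * f u * deriv g u + \<beta>\<^sup>2 * g u * deriv f u)
               / (\<alpha>\<^sup>2 * (f u)\<^sup>2 + \<beta>\<^sup>2 * (g u)\<^sup>2)))))"
proof (intro conjI impI)
  assume G: "\<forall>u\<in>J. \<alpha>\<^sup>2 * (f u)\<^sup>2 - \<beta>\<^sup>2 * (g u)\<^sup>2 > 0" and E: "\<forall>u\<in>J. (deriv f u)\<^sup>2 + (deriv g u)\<^sup>2 > 0"
    and free: "free_of_flat_points (rot_surface1 \<alpha> \<beta> f g) (J \<times> {0..<2*pi})"
  interpret rotational_frame \<alpha> \<beta> 1
      "\<lambda>v. vector [cos (\<alpha> * v), sin (\<alpha> * v), 0, 0]" "\<lambda>v. vector [- sin (\<alpha> * v), cos (\<alpha> * v), 0, 0]"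
      "\<lambda>v. vector [0, 0, cosh (\<beta> * v), sinh (\<beta> * v)]" "\<lambda>v. vector [0, 0, sinh (\<beta> * v), cosh (\<beta> * v)]"
    by (rule rotational_frame_hyperbolic(1))
  interpret rotational_surface \<alpha> \<beta> 1
      "\<lambda>v. vector [cos (\<alpha> * v), sin (\<alpha> * v), 0, 0]" "\<lambda>v. vector [- sin (\<alpha> * v), cos (\<alpha> * v), 0, 0]"
      "\<lambda>v. vector [0, 0, cosh (\<beta> * v), sinh (\<beta> * v)]" "\<lambda>v. vector [0, 0, sinh (\<beta> * v), cosh (\<beta> * v)]"
      J f g
    by unfold_locales (use assms E G in auto)
  \<comment> \<open>The two maps agree on the whole plane, so every notion about the surface
    transfers by rewriting.\<close>
  have z: "rot_surface1 \<alpha> \<beta> f g = z"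
  proof
    show "rot_surface1 \<alpha> \<beta> f g q = z q" for q
      by (cases q) (simp add: rot_surface1_def frame_field_def frame_vec_def vec_eq_iff forall_4)
  qed
  show "flat_normal_connection (rot_surface1 \<alpha> \<beta> f g) (J \<times> {0..<2*pi}) \<longleftrightarrow>
       (\<forall>u\<in>J.
          (deriv g u * deriv (deriv f) u - deriv f u * deriv (deriv g) u)
            / ((deriv f u)\<^sup>2 + (deriv g u)\<^sup>2)
          = - ((\<alpha>\<^sup>2 * f u * deriv g u + \<beta>\<^sup>2 * g u * deriv f u)
               / (\<alpha>\<^sup>2 * (f u)\<^sup>2 - \<beta>\<^sup>2 * (g u)\<^sup>2)))"
    using flat_normal_connection_iff[OF free[unfolded z]]
    unfolding z coeff_uu_def coeff_vv_def by simp
next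
  assume E: "\<forall>u\<in>J. (deriv f u)\<^sup>2 - (deriv g u)\<^sup>2 > 0" and G: "\<forall>u\<in>J. \<alpha>\<^sup>2 * (f u)\<^sup>2 + \<beta>\<^sup>2 * (g u)\<^sup>2 > 0"
    and free: "free_of_flat_points (rot_surface2 \<alpha> \<beta> f g) (J \<times> {0..<2*pi})"
  \<comment> \<open>The profile \<open>g\<close> now multiplies the timelike vector
    \<open>(0, 0, sinh, cosh)\<close>. This reverses the sign of the \<open>g\<close> terms in both
    \<open>E\<close> and \<open>G\<close>, as the second type requires.\<close>
  interpret rotational_frame \<alpha> \<beta> "-1"
      "\<lambda>v. vector [cos (\<alpha> * v), sin (\<alpha> * v), 0, 0]" "\<lambda>v. vector [- sin (\<alpha> * v), cos (\<alpha> * v), 0, 0]"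
      "\<lambda>v. vector [0, 0, sinh (\<beta> * v), cosh (\<beta> * v)]" "\<lambda>v. vector [0, 0, cosh (\<beta> * v), sinh (\<beta> * v)]"
    by (rule rotational_frame_hyperbolic(2))
  interpret rotational_surface \<alpha> \<beta> "-1"
      "\<lambda>v. vector [cos (\<alpha> * v), sin (\<alpha> * v), 0, 0]" "\<lambda>v. vector [- sin (\<alpha> * v), cos (\<alpha> * v), 0, 0]"
      "\<lambda>v. vector [0, 0, sinh (\<beta> * v), cosh (\<beta> * v)]" "\<lambda>v. vector [0, 0, cosh (\<beta> * v), sinh (\<beta> * v)]"
      J f g
    by unfold_locales (use assms E G in auto)
  have z: "rot_surface2 \<alpha> \<beta> f g = z"
  proof
    show "rot_surface2 \<alpha> \<beta> f g q = z q" for q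
      by (cases q) (simp add: rot_surface2_def frame_field_def frame_vec_def vec_eq_iff forall_4)
  qed
  show "flat_normal_connection (rot_surface2 \<alpha> \<beta> f g) (J \<times> {0..<2*pi}) \<longleftrightarrow>
       (\<forall>u\<in>J.
          (deriv g u * deriv (deriv f) u - deriv f u * deriv (deriv g) u)
            / ((deriv f u)\<^sup>2 - (deriv g u)\<^sup>2)
          = - ((\<alpha>\<^sup>2 * f u * deriv g u + \<beta>\<^sup>2 * g u * deriv f u)
               / (\<alpha>\<^sup>2 * (f u)\<^sup>2 + \<beta>\<^sup>2 * (g u)\<^sup>2)))"
    using flat_normal_connection_iff[OF free[unfolded z]]
    unfolding z coeff_uu_def coeff_vv_def by simp
qed

end
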